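(* Let $F$ be a finite field and let $C,D\subseteq F^n$ be linear codes such that the pair $(C,D)$ is PMDS, i.e. $d_{\min}(CD)\ge 2$ and $d_{\min}(CD)=n-\dim C-\dim D+2$, and assume $d_{\min}(CD)>2$. Then $C$, $D$ and $CD$ are MDS. Moreover, if $\dim C,\dim D\ge 2$, then $C$, $D$ and $CD$ are Reed-Solomon codes with a common evaluation-point sequence.
   Context: A (linear) code is an $F$-linear subspace of $F^n$. For $x,y\in F^n$, $xy$ denotes the coordinatewise product; $CD$ is the $F$-span of all $xy$ with $x\in C$, $y\in D$. $d_{\min}$ is the minimum Hamming weight of a non-zero vector. A code $C\subseteq F^n$ is MDS if $\dim C+d_{\min}(C)=n+1$. A Reed-Solomon code of length $n$ and dimension $k$ is a code of the form $\{(g_1f(\alpha_1),\dots,g_nf(\alpha_n)): f\in F[X],\ \deg f<k\}$, where $g_1,\dots,g_n\in F$ are non-zero and $\alpha_1,\dots,\alpha_n\in F\cup\{\infty\}$ are pairwise distinct, with the convention that $f(\infty)$ is the coefficient of $X^{k-1}$ in $f$; $(\alpha_1,\dots,\alpha_n)$ is called an evaluation-point sequence for the code.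
   Formalization: It is additionally assumed that C and D have full support (no coordinate vanishes on the whole code); without this the claim fails, e.g. for C = ⟨1110⟩, D = ⟨1110, 0001⟩, and every excluded pair violates the MDS conclusion. *)

theory Defs
  imports "HOL-Analysis.Analysis" "HOL-Computational_Algebra.Polynomial"
begin

text \<open>
  Words of length \<open>n\<close> over \<open>F\<close> are vectors \<open>'a ^ 'n\<close> with \<open>n = CARD('n)\<close>, linear codes are sets
  satisfying \<^term>\<open>vec.subspace\<close>, and \<open>x * y\<close> on \<open>'a ^ 'n\<close> is the coordinatewise product.
\<close>

definition hamming_weight :: "'a::zero ^ 'n \<Rightarrow> nat" where
  "hamming_weight x = card {i. x $ i \<noteq> 0}"

text \<open>The zero code has no minimum distance; here it gets the junk value \<open>Inf {} = 0\<close>.\<close>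

definition d_min :: "('a::zero ^ 'n) set \<Rightarrow> nat" where
  "d_min C = Inf {hamming_weight x |x. x \<in> C \<and> x \<noteq> 0}"

definition code_prod :: "('a::field ^ 'n) set \<Rightarrow> ('a ^ 'n) set \<Rightarrow> ('a ^ 'n) set" where
  "code_prod C D = vec.span {x * y |x y. x \<in> C \<and> y \<in> D}"

text \<open>
  Every non-zero MDS code has full support, but a pair \<open>(C, D)\<close> with
  \<open>d\<^sub>m\<^sub>i\<^sub>n(CD) = n - dim C - dim D + 2 > 2\<close> need not:
  take \<open>C = \<langle>1110\<rangle>\<close> and \<open>D = \<langle>1110, 0001\<rangle>\<close>.
\<close>

definition full_support :: "('a::zero ^ 'n) set \<Rightarrow> bool" where
  "full_support C \<longleftrightarrow> (\<forall>i. \<exists>x\<in>C. x $ i \<noteq> 0)"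

definition MDS :: "('a::field ^ 'n) set \<Rightarrow> bool" where
  "MDS C \<longleftrightarrow> vec.dim C + d_min C = CARD('n) + 1"

definition PMDS :: "('a::field ^ 'n) set \<Rightarrow> ('a ^ 'n) set \<Rightarrow> bool" where
  "PMDS C D \<longleftrightarrow> d_min (code_prod C D) \<ge> 2 \<and>
     int (d_min (code_prod C D)) = int CARD('n) - int (vec.dim C) - int (vec.dim D) + 2"

datatype 'a eval_point = Finite_Point 'a | Infinity_Point

fun eval_at :: "nat \<Rightarrow> 'a::comm_semiring_0 poly \<Rightarrow> 'a eval_point \<Rightarrow> 'a" where
  "eval_at k f (Finite_Point a) = poly f a"
| "eval_at k f Infinity_Point = coeff f (k - 1)"

text \<open>
  The library has \<open>degree 0 = 0\<close>, whereas \<open>deg 0 < k\<close> is meant to hold for every \<open>k\<close>; hence the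
  disjunct \<open>f = 0\<close>, which only matters for \<open>k = 0\<close>.
\<close>

definition RS_code :: "nat \<Rightarrow> 'a::field ^ 'n \<Rightarrow> ('n \<Rightarrow> 'a eval_point) \<Rightarrow> ('a ^ 'n) set" where
  "RS_code k g \<alpha> = {(\<chi> i. g $ i * eval_at k f (\<alpha> i)) |f. f = 0 \<or> degree f < k}"

text \<open>\<open>C\<close> is a Reed-Solomon code, of dimension \<open>dim C\<close>, with evaluation-point sequence \<open>\<alpha>\<close>.\<close>

definition is_RS_with_points :: "('n \<Rightarrow> 'a::field eval_point) \<Rightarrow> ('a ^ 'n) set \<Rightarrow> bool" where
  "is_RS_with_points \<alpha> C \<longleftrightarrow>
     inj \<alpha> \<and> (\<exists>g. (\<forall>i. g $ i \<noteq> 0) \<and> C = RS_code (vec.dim C) g \<alpha>)"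

end

theory Submission
  imports Defs
begin

text \<open>
  Shortening \<open>C\<close> at a coordinate \<open>i\<close>, and restricting \<open>D\<close> to the support of the shortened code, does
  not decrease the minimum distance of the product. Induction along this step proves the product
  Singleton bound. In case of equality with \<open>d > 2\<close> the step loses exactly one coordinate and one
  dimension of \<open>C\<close>, and equality persists; hence \<open>C\<close> and \<open>D\<close> are MDS and
  \<open>dim CD = dim C + dim D - 1\<close>.

  Let \<open>c\<^sub>t\<close> \<open>(t \<in> T)\<close> be the basis of \<open>C\<close> dual to an information set \<open>T\<close>. Shortening both codes until
  their dimensions are 3 and 2 shows that any three of the words \<open>1 / c\<^sub>t\<close> on the complement of \<open>T\<close>
  are linearly dependent, so all of them lie in a two-dimensional space. In other words \<open>C\<close> has a
  generator matrix \<open>[I | A]\<close> with a generalised Cauchy matrix \<open>A\<close>, which means that \<open>C\<close> is a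
  Reed-Solomon code. Once \<open>C\<close> is known, the product Singleton bound gives
  \<open>dim (UD + VD) \<le> dim D + 1\<close> for the homogeneous coordinates \<open>(U : V)\<close> of its evaluation points, and
  this forces \<open>D\<close> to be a Reed-Solomon code with the same points.
\<close>

subsection \<open>Supports, weights and shortened codes\<close>

definition code_support :: "('a::zero ^ 'n) set \<Rightarrow> 'n set" where
  "code_support C = {i. \<exists>x\<in>C. x $ i \<noteq> 0}"

text \<open>A lower bound instead of \<open>d_min\<close>: it passes to subcodes and holds vacuously
  for the zero code, where \<open>d_min\<close> has a junk value.\<close>

definition min_weight_ge :: "nat \<Rightarrow> ('a::zero ^ 'n) set \<Rightarrow> bool" where
  "min_weight_ge d C \<longleftrightarrow> (\<forall>x\<in>C. x \<noteq> 0 \<longrightarrow> d \<le> hamming_weight x)"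

definition shorten :: "'n set \<Rightarrow> ('a::zero ^ 'n) set \<Rightarrow> ('a ^ 'n) set" where
  "shorten J C = {x \<in> C. \<forall>i\<in>J. x $ i = 0}"

text \<open>Restriction to \<open>S\<close> is multiplication by this indicator word, so all codes
  keep the same ambient space and the support acts as the effective length.\<close>

definition mask :: "'n set \<Rightarrow> 'a::zero_neq_one ^ 'n" where
  "mask S = (\<chi> i. if i \<in> S then 1 else 0)"

lemma mask_nth [simp]: "mask S $ i = (if i \<in> S then 1 else 0)"
  by (simp add: mask_def)

lemma linear_times: "Vector_Spaces.linear (*s) (*s) ((*) (w :: 'a::field ^ 'n))"
  by unfold_locales (vector algebra_simps)+

lemma subspace_times_image:
  "vec.subspace C \<Longrightarrow> vec.subspace ((*) (w :: 'a::field ^ 'n) ` C)"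
  using linear_times[of w] vec.linear_subspace_image by blast

lemma subspace_shorten: "vec.subspace C \<Longrightarrow> vec.subspace (shorten J (C :: ('a::field ^ 'n) set))"
  by (auto simp: vec.subspace_def shorten_def)

lemma subspace_code_prod: "vec.subspace (code_prod C D)"
  by (simp add: code_prod_def)

lemma times_in_code_prod: "x \<in> C \<Longrightarrow> y \<in> D \<Longrightarrow> x * y \<in> code_prod C D"
  unfolding code_prod_def by (rule vec.span_base) blast

lemma code_prod_least:
  assumes "vec.subspace E" and "\<And>x y. x \<in> C \<Longrightarrow> y \<in> D \<Longrightarrow> x * y \<in> E"
  shows "code_prod C D \<subseteq> E"
  unfolding code_prod_def by (rule vec.span_minimal) (use assms in auto)

lemma code_prod_commute: "code_prod C D = code_prod D C"
  unfolding code_prod_def by (rule arg_cong[where f = vec.span]) (auto; metis mult.commute)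

lemma min_weight_geD: "min_weight_ge d C \<Longrightarrow> x \<in> C \<Longrightarrow> x \<noteq> 0 \<Longrightarrow> d \<le> hamming_weight x"
  by (auto simp: min_weight_ge_def)

lemma min_weight_ge_subset: "min_weight_ge d D \<Longrightarrow> C \<subseteq> D \<Longrightarrow> min_weight_ge d C"
  by (auto simp: min_weight_ge_def)

lemma hamming_weight_le:
  "(\<And>i. x $ i \<noteq> 0 \<Longrightarrow> i \<in> T) \<Longrightarrow> hamming_weight (x :: 'a::zero ^ 'n) \<le> card T"
  unfolding hamming_weight_def by (rule card_mono) auto

lemma dim_nonzeroE:
  assumes "vec.dim (C :: ('a::field ^ 'n) set) \<noteq> 0"
  obtains x where "x \<in> C" "x \<noteq> 0"
  using assms by (metis vec.dim_eq_0 subsetI singletonI)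

lemma dim_nonzeroI: "x \<in> C \<Longrightarrow> x \<noteq> (0 :: 'a::field ^ 'n) \<Longrightarrow> vec.dim C \<noteq> 0"
  by (auto simp: vec.dim_eq_0)

section \<open>Dimensions of shortened and restricted codes, Singleton bound\<close>

lemma dim_shorten_single:
  assumes C: "vec.subspace C" and c: "c \<in> C" "c $ i \<noteq> (0 :: 'a::field)"
  shows "vec.dim C = Suc (vec.dim (shorten {i} C))"
proof -
  have "x \<in> vec.span (insert c (shorten {i} C))" if x: "x \<in> C" for x
  proof -
    let ?y = "x - (x $ i / c $ i) *s c"
    have "?y \<in> shorten {i} C"
      using C c x by (auto simp: shorten_def intro!: vec.subspace_diff vec.subspace_scale)
    then have "?y + (x $ i / c $ i) *s c \<in> vec.span (insert c (shorten {i} C))"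
      by (intro vec.span_add vec.span_scale) (auto intro: vec.span_base)
    then show ?thesis by simp
  qed
  then have "vec.dim C \<le> vec.dim (insert c (shorten {i} C))"
    by (intro vec.dim_mono) auto
  moreover have "vec.dim (insert c (shorten {i} C)) \<le> vec.dim C"
    using c by (intro vec.dim_subset) (auto simp: shorten_def)
  moreover have "c \<notin> vec.span (shorten {i} C)"
    unfolding vec.span_eq_iff[THEN iffD2, OF subspace_shorten[OF C, of "{i}"]]
    using c by (simp add: shorten_def)
  ultimately show ?thesis
    by (simp add: vec.dim_insert)
qed

lemma dim_shorten:
  assumes C: "vec.subspace (C :: ('a::field ^ 'n) set)"
  shows "vec.dim C \<le> vec.dim (shorten J C) + card J"
proof (induction J rule: finite_induct[OF finite])
  case 1
  show ?case by (simp add: shorten_def)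
next
  case (2 i J)
  have eq: "shorten (insert i J) C = shorten {i} (shorten J C)"
    by (auto simp: shorten_def)
  show ?case
  proof (cases "\<exists>c\<in>shorten J C. c $ i \<noteq> 0")
    case True
    then show ?thesis
      using dim_shorten_single[OF subspace_shorten[OF C, of J]] 2 eq by auto
  next
    case False
    then have "shorten (insert i J) C = shorten J C"
      by (auto simp: shorten_def)
    then show ?thesis using 2 by simp
  qed
qed

lemma ex_nonzero_vanishing:
  assumes "vec.subspace (C :: ('a::field ^ 'n) set)" "card J < vec.dim C"
  obtains x where "x \<in> C" "x \<noteq> 0" "\<And>i. i \<in> J \<Longrightarrow> x $ i = 0"
proof -
  have "vec.dim (shorten J C) \<noteq> 0"
    using dim_shorten[OF assms(1), of J] assms(2) by linarith
  then obtain x where "x \<in> shorten J C" "x \<noteq> 0" by (rule dim_nonzeroE)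
  then show ?thesis using that by (auto simp: shorten_def)
qed

text \<open>By a dimension count some nonzero word vanishes on \<open>vec.dim E - 1\<close>
  coordinates of \<open>K\<close>; its support lies in the remaining ones.\<close>

lemma singleton_bound:
  assumes E: "vec.subspace (E :: ('a::field ^ 'n) set)"
    and supp: "code_support E \<subseteq> K" and d: "min_weight_ge d E" and nz: "vec.dim E \<noteq> 0"
  shows "vec.dim E + d \<le> Suc (card K)"
proof -
  have K: "x $ i = 0" if "x \<in> E" "i \<notin> K" for x i
    using supp that by (auto simp: code_support_def)
  have "vec.dim E \<le> card K"
  proof (rule ccontr)
    assume "\<not> ?thesis"
    then obtain x where "x \<in> E" "x \<noteq> 0" "\<And>i. i \<in> K \<Longrightarrow> x $ i = 0"
      using ex_nonzero_vanishing[OF E, of K] by auto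
    then show False using K by (metis vec_eq_iff zero_index)
  qed
  then have "vec.dim E - 1 \<le> card K" by simp
  then obtain J where J: "J \<subseteq> K" "card J = vec.dim E - 1"
    by (meson obtain_subset_with_card_n)
  obtain x where x: "x \<in> E" "x \<noteq> 0" "\<And>i. i \<in> J \<Longrightarrow> x $ i = 0"
    using ex_nonzero_vanishing[OF E, of J] J nz by auto
  have "d \<le> hamming_weight x" using d x by (auto simp: min_weight_ge_def)
  also have "\<dots> \<le> card (K - J)"
    using x K by (intro hamming_weight_le) auto
  also have "\<dots> = card K - (vec.dim E - 1)"
    using J by (simp add: card_Diff_subset)
  finally show ?thesis using \<open>vec.dim E \<le> card K\<close> nz by linarith
qed

lemma code_support_mask_image:
  "code_support ((*) (mask S) ` (D :: ('a::field ^ 'n) set)) = S \<inter> code_support D"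
  by (auto simp: code_support_def)

text \<open>Rank-nullity for restriction to \<open>S\<close>: \<open>D\<close> and its masked image
  have the same sum with the space \<open>?T\<close> of words vanishing on \<open>S\<close>, so the
  dimension formulas for the two sums can be compared.\<close>

lemma dim_mask_image:
  assumes D: "vec.subspace (D :: ('a::field ^ 'n) set)"
  shows "vec.dim D = vec.dim ((*) (mask S) ` D) + vec.dim (shorten S D)"
proof -
  let ?T = "{x :: 'a ^ 'n. \<forall>i\<in>S. x $ i = 0}" and ?w = "mask S :: 'a ^ 'n"
  have T: "vec.subspace ?T" by (auto simp: vec.subspace_def)
  have wD: "vec.subspace ((*) ?w ` D)" by (rule subspace_times_image[OF D])
  have "{x + y |x y. x \<in> D \<and> y \<in> ?T} = {x + y |x y. x \<in> (*) ?w ` D \<and> y \<in> ?T}" (is "?A = ?B")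
  proof (intro set_eqI iffI)
    fix z assume "z \<in> ?A"
    then obtain x y where "x \<in> D" "y \<in> ?T" "z = x + y" by auto
    then have "z = ?w * x + ((x - ?w * x) + y)" "?w * x \<in> (*) ?w ` D" "(x - ?w * x) + y \<in> ?T"
      by auto
    then show "z \<in> ?B" by blast
  next
    fix z assume "z \<in> ?B"
    then obtain x y where "x \<in> D" "y \<in> ?T" "z = ?w * x + y" by auto
    then have "z = x + ((?w * x - x) + y)" "x \<in> D" "(?w * x - x) + y \<in> ?T"
      by auto
    then show "z \<in> ?A" by blast
  qed
  moreover have "(*) ?w ` D \<inter> ?T = {0}"
    using vec.subspace_0[OF wD] by (auto simp: vec_eq_iff)
  moreover have "D \<inter> ?T = shorten S D" by (auto simp: shorten_def)
  ultimately show ?thesis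
    using vec.dim_sums_Int[OF D T] vec.dim_sums_Int[OF wD T] by simp
qed

subsection \<open>The product Singleton bound\<close>

text \<open>
  The coordinates on which every word of \<open>C\<close> is determined by its value at \<open>i\<close> are the ones lost
  when \<open>C\<close> is shortened at \<open>i\<close>. On them \<open>C\<close> is one-dimensional, so the subcode of \<open>D\<close> supported
  there inherits the minimum distance of \<open>CD\<close> and obeys the Singleton bound.
\<close>

lemma shorten_product:
  fixes C D :: "('a::field ^ 'n) set"
  assumes C: "vec.subspace C" and D: "vec.subspace D"
    and sC: "code_support C = S" and sD: "code_support D = S"
    and d: "min_weight_ge d (code_prod C D)" and i: "i \<in> S" and k: "2 \<le> vec.dim C"
  defines "S' \<equiv> code_support (shorten {i} C)"
  defines "D' \<equiv> (*) (mask S') ` D"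
  shows "S' \<subseteq> S - {i}" "S' \<noteq> {}" "code_support D' = S'" "min_weight_ge d (code_prod (shorten {i} C) D')"
    "vec.dim C = Suc (vec.dim (shorten {i} C))"
    "vec.dim D = vec.dim D' \<or> vec.dim D + d \<le> vec.dim D' + Suc (card (S - S'))"
proof -
  let ?C = "shorten {i} C" and ?E = "shorten S' D"
  show S': "S' \<subseteq> S - {i}"
    using sC by (auto simp: S'_def shorten_def code_support_def)
  obtain c where c: "c \<in> C" "c $ i \<noteq> 0"
    using i sC by (auto simp: code_support_def)
  show dC: "vec.dim C = Suc (vec.dim ?C)"
    by (rule dim_shorten_single[OF C c])
  then have "vec.dim ?C \<noteq> 0" using k by linarith
  then obtain x where "x \<in> ?C" "x \<noteq> 0" by (rule dim_nonzeroE)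
  then show "S' \<noteq> {}"
    by (auto simp: S'_def code_support_def vec_eq_iff)
  show "code_support D' = S'"
    unfolding D'_def code_support_mask_image using S' sD by auto
  have "code_prod ?C D' \<subseteq> code_prod C D"
  proof (rule code_prod_least[OF subspace_code_prod])
    fix x y assume x: "x \<in> ?C" and "y \<in> D'"
    then obtain z where z: "z \<in> D" "y = mask S' * z" by (auto simp: D'_def)
    have "x * y = x * z"
      using x z by (auto simp: vec_eq_iff S'_def code_support_def)
    then show "x * y \<in> code_prod C D"
      using x z by (auto simp: shorten_def intro: times_in_code_prod)
  qed
  then show "min_weight_ge d (code_prod ?C D')"
    using d min_weight_ge_subset by blast
  \<comment> \<open>If \<open>c\<close> vanished at \<open>j\<close>, cancelling the value at
    \<open>i\<close> of a word nonzero at \<open>j\<close> would leave its value at \<open>j\<close>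
    intact and put \<open>j\<close> into \<open>S'\<close>.\<close>
  have cK: "c $ j \<noteq> 0" if j: "j \<in> S - S'" for j
  proof
    assume "c $ j = 0"
    obtain b where b: "b \<in> C" "b $ j \<noteq> 0"
      using j sC by (auto simp: code_support_def)
    let ?b = "b - (b $ i / c $ i) *s c"
    have "?b \<in> ?C"
      using C b c by (auto simp: shorten_def intro!: vec.subspace_diff vec.subspace_scale)
    moreover have "?b $ j \<noteq> 0" using b \<open>c $ j = 0\<close> by simp
    ultimately have "j \<in> S'" unfolding S'_def code_support_def by blast
    with j show False by simp
  qed
  have sE: "code_support ?E \<subseteq> S - S'"
    using sD by (auto simp: code_support_def shorten_def)
  \<comment> \<open>\<open>c\<close> has no zero on the support of \<open>?E\<close>, so
    multiplication by \<open>c\<close> preserves weights and lands in the product code.\<close>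
  have "min_weight_ge d ?E"
    unfolding min_weight_ge_def
  proof (intro ballI impI)
    fix y assume y: "y \<in> ?E" "y \<noteq> 0"
    have supp: "(c * y) $ j \<noteq> 0 \<longleftrightarrow> y $ j \<noteq> 0" for j
      using cK[of j] sE y by (auto simp: code_support_def)
    then have "c * y \<noteq> 0" "hamming_weight (c * y) = hamming_weight y"
      using y(2) unfolding hamming_weight_def by (metis vec_eq_iff zero_index, metis (lifting))
    moreover have "c * y \<in> code_prod C D"
      using c y by (auto simp: shorten_def intro: times_in_code_prod)
    ultimately show "d \<le> hamming_weight y"
      using d by (metis min_weight_geD)
  qed
  then show "vec.dim D = vec.dim D' \<or> vec.dim D + d \<le> vec.dim D' + Suc (card (S - S'))"
    using singleton_bound[OF subspace_shorten[OF D] sE] dim_mask_image[OF D, of S']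
    by (fastforce simp: D'_def)
qed

text \<open>Base case of both inductions below. A nonzero word of the line \<open>C\<close> has no
  zero in \<open>S\<close>, because shortening there leaves only 0. So multiplication by it embeds
  \<open>D\<close> into \<open>code_prod C D\<close>, and the Singleton bound applies to the
  image.\<close>

lemma line_product_dim:
  fixes C D :: "('a::field ^ 'n) set"
  assumes C: "vec.subspace C" and D: "vec.subspace D"
    and sC: "code_support C = S" and sD: "code_support D = S" and S: "S \<noteq> {}"
    and d: "min_weight_ge d (code_prod C D)" and k: "vec.dim C = 1"
  shows "vec.dim D + d \<le> Suc (card S)" "\<And>x. x \<in> C \<Longrightarrow> x \<noteq> 0 \<Longrightarrow> hamming_weight x = card S"
    "vec.dim D \<le> vec.dim (code_prod C D)"
proof -
  obtain c where c: "c \<in> C" "c \<noteq> 0" using k by (metis dim_nonzeroE zero_neq_one)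
  have full: "x $ j \<noteq> 0" if x: "x \<in> C" "x \<noteq> 0" and j: "j \<in> S" for x j
  proof
    assume "x $ j = 0"
    obtain b where b: "b \<in> C" "b $ j \<noteq> 0" using j sC by (auto simp: code_support_def)
    then have "vec.dim (shorten {j} C) = 0" using dim_shorten_single[OF C b] k by simp
    then have "shorten {j} C \<subseteq> {0}" by (simp add: vec.dim_eq_0)
    then show False using x \<open>x $ j = 0\<close> by (auto simp: shorten_def)
  qed
  have supp: "x $ j = 0" if "x \<in> C" "j \<notin> S" for x j
    using sC that by (auto simp: code_support_def)
  have suppD: "x $ j = 0" if "x \<in> D" "j \<notin> S" for x j
    using sD that by (auto simp: code_support_def)
  show "hamming_weight x = card S" if "x \<in> C" "x \<noteq> 0" for x
    unfolding hamming_weight_def by (rule arg_cong[where f = card]) (use that full supp in blast)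
  have inj: "inj_on ((*) c) (vec.span D)"
  proof (rule inj_onI)
    fix x y assume xy: "x \<in> vec.span D" "y \<in> vec.span D" "c * x = c * y"
    have "x $ j = y $ j" for j
    proof (cases "j \<in> S")
      case True
      have "c $ j * x $ j = c $ j * y $ j" using xy(3) by (simp add: vec_eq_iff)
      then show ?thesis using full[OF c True] by simp
    next
      case False
      then show ?thesis using xy suppD D by (simp add: vec.span_eq_iff[THEN iffD2, OF D])
    qed
    then show "x = y" by (simp add: vec_eq_iff)
  qed
  have "vec.dim ((*) c ` D) = vec.dim D"
    using vec.dim_image_eq[OF linear_times inj] .
  moreover have sub: "(*) c ` D \<subseteq> code_prod C D" using c by (auto intro: times_in_code_prod)
  then have "vec.dim ((*) c ` D) \<le> vec.dim (code_prod C D)" by (rule vec.dim_subset)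
  ultimately show le: "vec.dim D \<le> vec.dim (code_prod C D)" by simp
  obtain i where "i \<in> S" using S by auto
  then obtain y where "y \<in> D" "y \<noteq> 0" using sD by (fastforce simp: code_support_def)
  then have "vec.dim D \<noteq> 0" by (rule dim_nonzeroI)
  moreover have "code_support ((*) c ` D) \<subseteq> S" using suppD by (auto simp: code_support_def)
  ultimately show "vec.dim D + d \<le> Suc (card S)"
    using singleton_bound[OF subspace_times_image[OF D, of c], of S d] min_weight_ge_subset[OF d sub]
    \<open>vec.dim ((*) c ` D) = vec.dim D\<close> by simp
qed

theorem product_singleton_bound:
  fixes C D :: "('a::field ^ 'n) set"
  assumes "vec.subspace C" "vec.subspace D"
    and "code_support C = S" "code_support D = S" "S \<noteq> {}"
    and "min_weight_ge d (code_prod C D)" "2 \<le> d"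
  shows "vec.dim C + vec.dim D + d \<le> card S + 2"
  using assms
proof (induction "vec.dim C" arbitrary: C D S rule: less_induct)
  case less
  obtain i where i: "i \<in> S" using less.prems by auto
  obtain c where "c \<in> C" "c $ i \<noteq> 0" using i less.prems(3) by (auto simp: code_support_def)
  then have "vec.dim C \<noteq> 0" by (intro dim_nonzeroI[of c]) auto
  then consider "vec.dim C = 1" | "2 \<le> vec.dim C" by linarith
  then show ?case
  proof cases
    case 1
    then show ?thesis using line_product_dim(1)[OF less.prems(1-6)] by simp
  next
    case 2
    let ?C = "shorten {i} C"
    let ?S = "code_support ?C"
    let ?D = "(*) (mask ?S) ` D"
    note * = shorten_product[OF less.prems(1-4,6) i 2]
    have "vec.dim ?C + vec.dim ?D + d \<le> card ?S + 2"
      using * less.prems by (intro less.hyps) (auto intro: subspace_shorten subspace_times_image)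
    moreover have "card ?S + card (S - ?S) = card S"
      using *(1) by (simp add: card_Diff_subset card_mono subset_iff)
    moreover have "card (S - ?S) \<ge> 1"
      using i *(1) by (metis Diff_iff One_nat_def Suc_leI card_gt_0_iff empty_iff finite insertI1 subsetD)
    \<comment> \<open>If masking keeps \<open>vec.dim D\<close>, a lost coordinate pays for the lost
      dimension of \<open>C\<close>. Otherwise the sum is at most \<open>card S + 4 - d\<close>, and
      \<open>2 \<le> d\<close> suffices.\<close>
    ultimately show ?thesis using *(5,6) \<open>2 \<le> d\<close> by linarith
  qed
qed

subsection \<open>Equality in the product Singleton bound\<close>

text \<open>Equality in \<open>product_singleton_bound\<close>, relative to a common support and
  with a mere lower bound on weights, so that shortening preserves the notion.\<close>

definition critical :: "'n set \<Rightarrow> nat \<Rightarrow> ('a::field ^ 'n) set \<Rightarrow> ('a ^ 'n) set \<Rightarrow> bool" where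
  "critical S d C D \<longleftrightarrow> vec.subspace C \<and> vec.subspace D \<and>
     code_support C = S \<and> code_support D = S \<and> min_weight_ge d (code_prod C D) \<and> 3 \<le> d \<and>
     vec.dim C + vec.dim D + d = card S + 2"

lemma critical_commute: "critical S d C D \<Longrightarrow> critical S d D C"
  by (auto simp: critical_def code_prod_commute)

lemma critical_shorten:
  assumes crit: "critical S d C D" and i: "i \<in> S" and k: "2 \<le> vec.dim C"
  shows "critical (S - {i}) d (shorten {i} C) ((*) (mask (S - {i})) ` D)"
    "vec.dim C = Suc (vec.dim (shorten {i} C))"
    "vec.dim ((*) (mask (S - {i})) ` D) = vec.dim D"
proof -
  from crit have C: "vec.subspace C" "vec.subspace D" "code_support C = S" "code_support D = S"
      "min_weight_ge d (code_prod C D)" and d: "3 \<le> d"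
    and eq: "vec.dim C + vec.dim D + d = card S + 2"
    by (auto simp: critical_def)
  let ?C = "shorten {i} C"
  let ?S = "code_support ?C"
  let ?D = "(*) (mask ?S) ` D"
  note * = shorten_product[OF C i k]
  have "vec.dim ?C + vec.dim ?D + d \<le> card ?S + 2"
    using * C d by (intro product_singleton_bound) (auto intro: subspace_shorten subspace_times_image)
  moreover have card: "card ?S + card (S - ?S) = card S"
    using *(1) by (simp add: card_Diff_subset card_mono subset_iff)
  moreover have "card (S - ?S) \<ge> 1"
    using i *(1) by (metis Diff_iff One_nat_def Suc_leI card_gt_0_iff empty_iff finite insertI1 subsetD)
  \<comment> \<open>The second alternative of \<open>shorten_product\<close> would bound the sum by
    \<open>card S + 4 - d\<close>, which contradicts equality since \<open>3 \<le> d\<close>. In the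
    first alternative equality leaves room for one lost coordinate only.\<close>
  ultimately have 1: "card (S - ?S) = 1" "vec.dim D = vec.dim ?D" using *(5,6) d eq by linarith+
  then have "?S = S - {i}" using *(1) i card
    by (intro card_subset_eq) (auto simp: card_Diff_subset)
  then show "critical (S - {i}) d (shorten {i} C) ((*) (mask (S - {i})) ` D)"
    "vec.dim C = Suc (vec.dim (shorten {i} C))"
    "vec.dim ((*) (mask (S - {i})) ` D) = vec.dim D"
    using * C d eq 1 card
    by (auto simp: critical_def intro: subspace_shorten subspace_times_image)
qed

lemma critical_dim_pos: "critical S d C D \<Longrightarrow> S \<noteq> {} \<and> vec.dim C \<noteq> 0"
proof -
  assume crit: "critical S d C D"
  have "S \<noteq> {}"
  proof
    assume "S = {}"
    then have "3 \<le> d" "vec.dim C + vec.dim D + d = 2" using crit unfolding critical_def by auto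
    then show False by linarith
  qed
  then obtain i x where "x \<in> C" "x $ i \<noteq> 0"
    using crit by (auto simp: critical_def code_support_def)
  then have "vec.dim C \<noteq> 0" by (intro dim_nonzeroI[of x]) auto
  with \<open>S \<noteq> {}\<close> show ?thesis by simp
qed

text \<open>Induction by shortening. A word with a zero in \<open>S\<close> lies in the code
  shortened there; a word without one weighs at least \<open>card S\<close>. Products of shortened
  words vanish at \<open>i\<close> while some product does not, so each step adds a dimension to the
  product code.\<close>

lemma critical_weight_and_dim:
  assumes "critical S d C D"
  shows "(\<forall>x\<in>C. x \<noteq> 0 \<longrightarrow> Suc (card S) \<le> vec.dim C + hamming_weight x) \<and>
    vec.dim C + vec.dim D \<le> Suc (vec.dim (code_prod C D))"
  using assms
proof (induction "vec.dim C" arbitrary: C D S rule: less_induct)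
  case less
  have C: "vec.subspace C" "vec.subspace D" "code_support C = S" "code_support D = S" "S \<noteq> {}"
      "min_weight_ge d (code_prod C D)"
    using less.prems critical_dim_pos[OF less.prems] by (auto simp: critical_def)
  consider "vec.dim C = 1" | "2 \<le> vec.dim C"
    using critical_dim_pos[OF less.prems] by linarith
  then show ?case
  proof cases
    case 1
    then show ?thesis using line_product_dim[OF C] by simp
  next
    case 2
    note step = critical_shorten[OF less.prems _ 2]
    obtain i where i: "i \<in> S" using C(5) by auto
    have wt: "Suc (card S) \<le> vec.dim C + hamming_weight x" if x: "x \<in> C" "x \<noteq> 0" for x
    proof (cases "\<exists>i\<in>S. x $ i = 0")
      case True
      then obtain j where j: "j \<in> S" "x $ j = 0" by blast
      then have "Suc (card (S - {j})) \<le> vec.dim (shorten {j} C) + hamming_weight x"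
        using less.hyps[OF _ step(1)[OF j(1)]] step(2)[OF j(1)] x by (auto simp: shorten_def)
      moreover have "card S = Suc (card (S - {j}))"
        using j(1) by (metis card_Suc_Diff1 finite)
      ultimately show ?thesis using step(2)[OF j(1)] by linarith
    next
      case False
      then have "card S \<le> hamming_weight x"
        unfolding hamming_weight_def by (intro card_mono) auto
      with 2 show ?thesis by linarith
    qed
    let ?C = "shorten {i} C" and ?D = "(*) (mask (S - {i})) ` D"
    have "vec.dim ?C + vec.dim ?D \<le> Suc (vec.dim (code_prod ?C ?D))"
      using less.hyps[OF _ step(1)[OF i]] step(2)[OF i] by simp
    moreover have "vec.dim (code_prod C D) = Suc (vec.dim (shorten {i} (code_prod C D)))"
    proof -
      obtain x y where xy: "x \<in> C" "y \<in> D" "x $ i \<noteq> 0" "y $ i \<noteq> 0"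
        using C(3,4) i unfolding code_support_def by blast
      show ?thesis
        by (rule dim_shorten_single[OF subspace_code_prod times_in_code_prod[OF xy(1,2)]])
          (use xy in simp)
    qed
    moreover have "code_prod ?C ?D \<subseteq> shorten {i} (code_prod C D)"
    proof (rule code_prod_least[OF subspace_shorten[OF subspace_code_prod]])
      fix x y assume x: "x \<in> ?C" and "y \<in> ?D"
      then obtain z where z: "z \<in> D" "y = mask (S - {i}) * z" by auto
      have x0: "x \<in> C" "x $ i = 0" "\<And>j. j \<notin> S \<Longrightarrow> x $ j = 0"
        using x C(3) by (auto simp: shorten_def code_support_def)
      then have "x * y = x * z" using z by (auto simp: vec_eq_iff)
      then show "x * y \<in> shorten {i} (code_prod C D)"
        using times_in_code_prod[OF x0(1) z(1)] x0(2) by (simp add: shorten_def)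
    qed
    then have "vec.dim (code_prod ?C ?D) \<le> vec.dim (shorten {i} (code_prod C D))"
      by (rule vec.dim_subset)
    ultimately show ?thesis using wt step(2,3)[OF i] by simp
  qed
qed

lemmas critical_weight = critical_weight_and_dim[THEN conjunct1, rule_format]

lemma critical_dim_prod:
  assumes "critical S d C D"
  shows "Suc (vec.dim (code_prod C D)) = vec.dim C + vec.dim D"
proof -
  have le: "vec.dim C + vec.dim D \<le> Suc (vec.dim (code_prod C D))"
    using critical_weight_and_dim[OF assms] by blast
  have "code_prod C D \<subseteq> {x. \<forall>i. i \<notin> S \<longrightarrow> x $ i = 0}"
    using assms by (intro code_prod_least)
      (auto simp: critical_def code_support_def vec.subspace_def)
  then have "code_support (code_prod C D) \<subseteq> S"
    by (auto simp: code_support_def)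
  then have "vec.dim (code_prod C D) + d \<le> Suc (card S)"
    using assms le critical_dim_pos[OF assms] critical_dim_pos[OF critical_commute[OF assms]]
    by (intro singleton_bound subspace_code_prod) (auto simp: critical_def simp del: vec.dim_eq_0)
  then show ?thesis using assms le by (simp add: critical_def del: vec.dim_eq_0)
qed

lemma critical_zeros:
  assumes crit: "critical S d C D" and x: "x \<in> C" "\<And>i. i \<in> Z \<Longrightarrow> x $ i = 0"
    and Z: "Z \<subseteq> S" "vec.dim C \<le> card Z"
  shows "x = 0"
proof (rule ccontr)
  assume "x \<noteq> 0"
  then have "Suc (card S) \<le> vec.dim C + hamming_weight x"
    by (rule critical_weight[OF crit x(1)])
  moreover have "hamming_weight x \<le> card (S - Z)"
    using x crit by (intro hamming_weight_le) (auto simp: critical_def code_support_def)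
  moreover have "card (S - Z) = card S - card Z" "card Z \<le> card S"
    using Z by (simp_all add: card_Diff_subset card_mono)
  ultimately show False using Z(2) by linarith
qed

lemma critical_separates:
  assumes "critical S d C D" "2 \<le> vec.dim C" "i \<in> S" "j \<in> S" "i \<noteq> j"
  obtains x where "x \<in> C" "x $ i = 0" "x $ j \<noteq> 0"
proof -
  have "j \<in> code_support (shorten {i} C)"
    using critical_shorten(1)[OF assms(1,3,2)] assms(4,5) by (simp add: critical_def)
  then show ?thesis using that by (auto simp: code_support_def shorten_def)
qed

lemma critical_shorten_set:
  assumes crit: "critical S d C D" and "J \<subseteq> S" and "card J < vec.dim C"
  shows "critical (S - J) d (shorten J C) ((*) (mask (S - J)) ` D) \<and>
    vec.dim C = vec.dim (shorten J C) + card J \<and>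
    vec.dim ((*) (mask (S - J)) ` D) = vec.dim D"
  using finite[of J] assms(2,3)
proof (induction J rule: finite_induct)
  case empty
  have "mask S * y = y" if "y \<in> D" for y
    using crit that by (auto simp: critical_def code_support_def vec_eq_iff)
  then have "(*) (mask S) ` D = D" by force
  moreover have "shorten {} C = C" by (simp add: shorten_def)
  ultimately show ?case using crit by simp
next
  case (insert i J)
  have eq: "shorten (insert i J) C = shorten {i} (shorten J C)"
    "S - insert i J = S - J - {i}"
    "(*) (mask (S - J - {i})) ` D = (*) (mask (S - J - {i})) ` (*) (mask (S - J)) ` D"
    by (auto simp: shorten_def image_image vec_eq_iff intro!: image_cong)
  have IH: "critical (S - J) d (shorten J C) ((*) (mask (S - J)) ` D)"
    "vec.dim C = vec.dim (shorten J C) + card J"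
    "vec.dim ((*) (mask (S - J)) ` D) = vec.dim D"
    using insert by auto
  have i: "i \<in> S - J" and k: "2 \<le> vec.dim (shorten J C)"
    using insert IH(2) by auto
  show ?case
    using critical_shorten[OF IH(1) i k] IH(2,3) insert(1,2)
    unfolding eq by simp
qed

text \<open>
  Words of the quotient \<open>{w. uw \<in> C \<and> vw \<in> C}\<close> correspond to words \<open>uvw\<close> of \<open>uC \<inter> vC\<close>, whose
  dimension is known from that of \<open>uC + vC\<close>.
\<close>

lemma dim_quotient_ge:
  fixes C :: "('a::field ^ 'n) set"
  assumes C: "vec.subspace C" and S: "code_support C \<subseteq> S"
    and uv: "\<And>i. i \<in> S \<Longrightarrow> u $ i \<noteq> 0 \<or> v $ i \<noteq> 0"
    and inj: "inj_on ((*) u) C" "inj_on ((*) v) C"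
  defines "W \<equiv> {w. (\<forall>i. i \<notin> S \<longrightarrow> w $ i = 0) \<and> u * w \<in> C \<and> v * w \<in> C}"
  shows "vec.subspace W" "2 * vec.dim C \<le> vec.dim W + vec.dim {u * x + v * y |x y. x \<in> C \<and> y \<in> C}"
proof -
  have C': "vec.span C = C" using C by (simp add: vec.span_eq_iff)
  have "{u * x + v * y |x y. x \<in> C \<and> y \<in> C} = {x + y |x y. x \<in> (*) u ` C \<and> y \<in> (*) v ` C}"
    by blast
  then have "vec.dim {u * x + v * y |x y. x \<in> C \<and> y \<in> C} + vec.dim ((*) u ` C \<inter> (*) v ` C) =
      vec.dim ((*) u ` C) + vec.dim ((*) v ` C)"
    using vec.dim_sums_Int[OF subspace_times_image[OF C] subspace_times_image[OF C]] by metis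
  moreover have "vec.dim ((*) u ` C) = vec.dim C" "vec.dim ((*) v ` C) = vec.dim C"
    using inj by (auto intro!: vec.dim_image_eq linear_times simp: C')
  moreover have "(*) u ` C \<inter> (*) v ` C \<subseteq> (*) (u * v) ` W"
  proof
    fix z assume "z \<in> (*) u ` C \<inter> (*) v ` C"
    then obtain a b where ab: "a \<in> C" "b \<in> C" "z = u * a" "u * a = v * b" by auto
    then have eq: "u $ i * a $ i = v $ i * b $ i" for i by (metis vector_mult_component)
    \<comment> \<open>\<open>w\<close> is the common quotient of \<open>a\<close> by
      \<open>v\<close> and of \<open>b\<close> by \<open>u\<close>; where \<open>v\<close> vanishes,
      \<open>u * a = v * b\<close> makes \<open>a\<close> vanish too.\<close>
    define w where "w = (\<chi> i. if v $ i \<noteq> 0 then a $ i / v $ i else b $ i / u $ i)"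
    have supp: "a $ i = 0" "b $ i = 0" if "i \<notin> S" for i
      using S ab that by (auto simp: code_support_def)
    have "u $ i * w $ i = b $ i \<and> v $ i * w $ i = a $ i" for i
      using eq[of i] uv[of i] supp[of i] by (cases "i \<in> S") (auto simp: w_def field_simps)
    then have "u * w = b" "v * w = a" by (simp_all add: vec_eq_iff)
    moreover have "w $ i = 0" if "i \<notin> S" for i using supp[OF that] by (simp add: w_def)
    ultimately have "w \<in> W" using ab by (simp add: W_def)
    moreover have "z = u * v * w" using ab \<open>v * w = a\<close> by (simp add: mult.assoc)
    ultimately show "z \<in> (*) (u * v) ` W" by blast
  qed
  then have "vec.dim ((*) u ` C \<inter> (*) v ` C) \<le> vec.dim W"
    using vec.dim_image_le[OF linear_times, of "u * v" W] vec.dim_subset order_trans by blast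
  ultimately show "2 * vec.dim C \<le> vec.dim W + vec.dim {u * x + v * y |x y. x \<in> C \<and> y \<in> C}"
    by linarith
  have lin: "u * (c *s x) = c *s (u * x)" "u * (x + y) = u * x + u * y" for u x y :: "'a ^ 'n" and c
    by (vector algebra_simps)+
  show "vec.subspace W"
    using C unfolding W_def vec.subspace_def by (simp add: lin)
qed

subsection \<open>Reciprocals of interpolating words\<close>

lemma critical_card: "critical S d C D \<Longrightarrow> 3 \<le> d \<and> vec.dim C + vec.dim D + d = card S + 2"
  by (auto simp: critical_def)

text \<open>
  Write \<open>D\<close> as the span of \<open>u\<close> and \<open>v\<close>. Since \<open>dim (uC + vC) \<le> dim CD = 4\<close>, the words \<open>w\<close> with
  \<open>wD \<subseteq> C\<close> form a code of dimension at least 2, hence some \<open>w \<noteq> 0\<close> of this kind vanishes at any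
  prescribed coordinate. If \<open>l\<^sub>i \<in> D\<close> vanishes at \<open>a\<^sub>i\<close> and \<open>w\<close> vanishes at \<open>a\<^sub>1\<close>, then \<open>w l\<^sub>2\<close> and
  \<open>w l\<^sub>3\<close> are multiples of \<open>c\<^sub>3\<close> and \<open>c\<^sub>2\<close>. So \<open>1 / c\<^sub>i\<close> is proportional to \<open>l\<^sub>i\<close> up to a factor common
  to all three, and the \<open>l\<^sub>i\<close> are linearly dependent.
\<close>

lemma critical_3_2:
  fixes C D :: "('a::field ^ 'n) set"
  assumes crit: "critical S d C D" and k: "vec.dim C = 3" and l: "vec.dim D = 2"
    and a: "a1 \<in> S" "a2 \<in> S" "a3 \<in> S" "a1 \<noteq> a2" "a1 \<noteq> a3" "a2 \<noteq> a3"
    and c: "c1 \<in> C" "c2 \<in> C" "c3 \<in> C"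
    and c1: "c1 $ a1 = 1" "c1 $ a2 = 0" "c1 $ a3 = 0"
    and c2: "c2 $ a1 = 0" "c2 $ a2 = 1" "c2 $ a3 = 0"
    and c3: "c3 $ a1 = 0" "c3 $ a2 = 0" "c3 $ a3 = 1"
  shows "\<exists>\<rho> \<mu>. \<forall>p\<in>S - {a1, a2, a3}. 1 / c3 $ p = \<rho> / c1 $ p + \<mu> / c2 $ p"
proof -
  have C: "vec.subspace C" and D: "vec.subspace D"
    and sC: "code_support C = S" and sD: "code_support D = S" and d: "3 \<le> d"
    and card: "card S = 3 + d"
    using crit k l by (auto simp: critical_def)
  have zC: "x = 0" if "x \<in> C" "\<And>i. i \<in> Z \<Longrightarrow> x $ i = 0" "Z \<subseteq> S" "3 \<le> card Z" for x Z
    using critical_zeros[OF crit that(1,2,3)] that(4) k by simp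
  have zD: "x = 0" if "x \<in> D" "\<And>i. i \<in> Z \<Longrightarrow> x $ i = 0" "Z \<subseteq> S" "2 \<le> card Z" for x Z
    using critical_zeros[OF critical_commute[OF crit] that(1,2,3)] that(4) l by simp
  have zD2: "x $ j \<noteq> 0" if "x \<in> D" "x \<noteq> 0" "x $ i = 0" "i \<in> S" "j \<in> S" "i \<noteq> j" for x i j
  proof
    assume "x $ j = 0"
    then have "x = 0" using that by (intro zD[OF that(1), of "{i, j}"]) auto
    with that show False by simp
  qed
  have ex: "\<exists>x\<in>D. x \<noteq> 0 \<and> x $ i = 0" for i
    by (rule ex_nonzero_vanishing[OF D, of "{i}"]) (use l in auto)
  obtain u where u: "u \<in> D" "u \<noteq> 0" "u $ a1 = 0" using ex by blast
  obtain v where v: "v \<in> D" "v \<noteq> 0" "v $ a2 = 0" using ex by blast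
  obtain r where r: "r \<in> D" "r \<noteq> 0" "r $ a3 = 0" using ex by blast
  note uz = zD2[OF u a(1)] and vz = zD2[OF v a(2)] and rz = zD2[OF r a(3)]
  obtain A B where r_eq: "r = A *s u + B *s v"
  proof
    let ?x = "r - ((r $ a2 / u $ a2) *s u + (r $ a1 / v $ a1) *s v)"
    have "?x = 0"
    proof (rule zD[of _ "{a1, a2}"])
      show "?x \<in> D" using D u v r by (intro vec.subspace_diff vec.subspace_add vec.subspace_scale) auto
    qed (use a u v uz[of a2] vz[of a1] in auto)
    then show "r = (r $ a2 / u $ a2) *s u + (r $ a1 / v $ a1) *s v" by simp
  qed
  \<comment> \<open>A nonzero word of \<open>D\<close> has at most one zero in \<open>S\<close>, so
    words with equal products agree on at least \<open>card S - 1\<close> coordinates of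
    \<open>S\<close>, more than the three that determine a word of \<open>C\<close>.\<close>
  have inj: "inj_on ((*) x) C" if x: "x \<in> D" "x \<noteq> 0" for x
  proof (rule inj_onI)
    fix y z assume yz: "y \<in> C" "z \<in> C" "x * y = x * z"
    define Z where "Z = {i \<in> S. x $ i \<noteq> 0}"
    have "card (S - Z) \<le> 1"
    proof (rule ccontr)
      assume "\<not> ?thesis"
      then have "x = 0" using x by (intro zD[of x "S - Z"]) (auto simp: Z_def)
      with x show False by simp
    qed
    moreover have "card (S - Z) = card S - card Z" "card Z \<le> card S"
      by (auto simp: Z_def intro: card_mono card_Diff_subset)
    ultimately have "3 \<le> card Z" using card d by linarith
    moreover have "(y - z) $ i = 0" if "i \<in> Z" for i
      using that yz(3) by (simp add: Z_def vec_eq_iff) metis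
    ultimately have "y - z = 0"
      using yz C by (intro zC[of _ Z] vec.subspace_diff) (auto simp: Z_def)
    then show "y = z" by simp
  qed
  define W where "W = {w. (\<forall>i. i \<notin> S \<longrightarrow> w $ i = 0) \<and> u * w \<in> C \<and> v * w \<in> C}"
  have cover: "u $ i \<noteq> 0 \<or> v $ i \<noteq> 0" if "i \<in> S" for i
    using uz[of i] vz[of i] that a by metis
  have W: "vec.subspace W"
    and dW: "2 * vec.dim C \<le> vec.dim W + vec.dim {u * x + v * y |x y. x \<in> C \<and> y \<in> C}"
    unfolding W_def using dim_quotient_ge[OF C _ cover inj[OF u(1,2)] inj[OF v(1,2)]] sC by auto
  have "{u * x + v * y |x y. x \<in> C \<and> y \<in> C} \<subseteq> code_prod C D"
  proof
    fix z assume "z \<in> {u * x + v * y |x y. x \<in> C \<and> y \<in> C}"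
    then obtain x y where xy: "x \<in> C" "y \<in> C" "z = x * u + y * v"
      by (auto simp: mult.commute)
    then show "z \<in> code_prod C D"
      using vec.subspace_add[OF subspace_code_prod times_in_code_prod times_in_code_prod] u v by blast
  qed
  then have "vec.dim {u * x + v * y |x y. x \<in> C \<and> y \<in> C} \<le> vec.dim (code_prod C D)"
    by (rule vec.dim_subset)
  with critical_dim_prod[OF crit] dW k l have "2 \<le> vec.dim W" by linarith
  have exW: "\<exists>w\<in>W. w \<noteq> 0 \<and> w $ i = 0" for i
    by (rule ex_nonzero_vanishing[OF W, of "{i}"]) (use \<open>2 \<le> vec.dim W\<close> in auto)
  have DW: "x * w \<in> C" if "x \<in> {u, v, r}" "w \<in> W" for x w
  proof -
    have "u * w \<in> C" "v * w \<in> C" using that by (auto simp: W_def)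
    moreover have "r * w = A *s (u * w) + B *s (v * w)"
      by (simp add: r_eq vec_eq_iff algebra_simps)
    ultimately show ?thesis
      using that C by (auto intro!: vec.subspace_add vec.subspace_scale)
  qed
  \<comment> \<open>\<open>x * w\<close> and \<open>y\<close> both vanish at \<open>i\<close> and
    \<open>j\<close>; the scalar makes them agree at \<open>m\<close>, and three coordinates
    determine a word of \<open>C\<close>.\<close>
  have multiple: "\<exists>\<beta>. \<beta> \<noteq> 0 \<and> x * w = \<beta> *s y"
    if w: "w \<in> W" "w \<noteq> 0" "w $ i = 0" and x: "x \<in> {u, v, r}" "x $ j = 0"
      and y: "y \<in> C" "y $ i = 0" "y $ j = 0" "y $ m = 1"
      and ij: "i \<in> S" "j \<in> S" "m \<in> S" "i \<noteq> j" "i \<noteq> m" "j \<noteq> m" for w x y i j m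
  proof -
    let ?\<beta> = "(x * w) $ m"
    have xD: "x \<in> D" "x \<noteq> 0" using x u v r by auto
    have "x * w - ?\<beta> *s y = 0"
    proof (rule zC[of _ "{i, j, m}"])
      show "x * w - ?\<beta> *s y \<in> C"
        using C DW[OF x(1) w(1)] y by (intro vec.subspace_diff vec.subspace_scale)
    qed (use w x y ij in auto)
    then have eq: "x * w = ?\<beta> *s y" by (simp only: right_minus_eq)
    \<comment> \<open>A zero scalar would make \<open>w\<close> vanish on \<open>S - {j}\<close>;
      then \<open>u * w\<close> and \<open>v * w\<close> have at least three zeros in
      \<open>S\<close>, so they are 0, and \<open>w\<close> with them.\<close>
    moreover have "?\<beta> \<noteq> 0"
    proof
      assume "?\<beta> = 0"
      with eq have "x * w = 0" by (metis vec.scale_zero_left)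
      then have w0: "w $ p = 0" if "p \<in> S - {j}" for p
        using zD2[OF xD x(2) ij(2), of p] that by (auto simp: vec_eq_iff)
      have "3 \<le> card (S - {j})" using card d ij(2) by (simp add: card_Diff_singleton)
      then obtain Z where Z: "Z \<subseteq> S - {j}" "card Z = 3"
        by (meson obtain_subset_with_card_n)
      have "u * w = 0" "v * w = 0"
        using DW[OF _ w(1)] w0[OF subsetD[OF Z(1)]] Z by (auto intro!: zC[of _ Z])
      then have "w $ p = 0" for p
        using cover[of p] w(1) by (cases "p \<in> S") (auto simp: W_def vec_eq_iff)
      then show False using w(2) by (simp add: vec_eq_iff)
    qed
    ultimately show ?thesis by blast
  qed
  obtain w1 where w1: "w1 \<in> W" "w1 \<noteq> 0" "w1 $ a1 = 0" using exW by blast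
  obtain w2 where w2: "w2 \<in> W" "w2 \<noteq> 0" "w2 $ a2 = 0" using exW by blast
  obtain \<alpha> where \<alpha>: "\<alpha> \<noteq> 0" "v * w1 = \<alpha> *s c3"
    using multiple[OF w1, of v a2 c3 a3] v c c3 a by auto
  obtain \<beta> where \<beta>: "\<beta> \<noteq> 0" "r * w1 = \<beta> *s c2"
    using multiple[OF w1, of r a3 c2 a2] r c c2 a by auto
  obtain \<gamma> where \<gamma>: "\<gamma> \<noteq> 0" "r * w2 = \<gamma> *s c1"
    using multiple[OF w2, of r a3 c1 a1] r c c1 a by auto
  obtain \<delta> where \<delta>: "\<delta> \<noteq> 0" "u * w2 = \<delta> *s c3"
    using multiple[OF w2, of u a1 c3 a3] u c c3 a by auto
  \<comment> \<open>Eliminating \<open>w1\<close> and \<open>w2\<close> gives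
    \<open>u = r \<delta> c3 / (\<gamma> c1)\<close> and
    \<open>v = r \<alpha> c3 / (\<beta> c2)\<close> away from the three points; dividing
    \<open>r = A u + B v\<close> by \<open>r c3\<close> yields these coefficients.\<close>
  define \<rho> where "\<rho> = A * (\<delta> / \<gamma>)"
  define \<mu> where "\<mu> = B * (\<alpha> / \<beta>)"
  have "1 / c3 $ p = \<rho> / c1 $ p + \<mu> / c2 $ p" if p: "p \<in> S - {a1, a2, a3}" for p
  proof -
    have nz: "y $ p \<noteq> 0" if "y \<in> C" "y $ m = 1" "y $ i = 0" "y $ j = 0"
      "i \<in> {a1, a2, a3}" "j \<in> {a1, a2, a3}" "i \<noteq> j" for y i j m
    proof
      assume "y $ p = 0"
      with that p a have "y = 0" by (intro zC[of y "{i, j, p}"]) auto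
      with that show False by simp
    qed
    have nz1: "c1 $ p \<noteq> 0" "c2 $ p \<noteq> 0" "c3 $ p \<noteq> 0"
      using nz[of c1 a1 a2 a3] nz[of c2 a2 a1 a3] nz[of c3 a3 a1 a2] c c1 c2 c3 a by auto
    have nz2: "r $ p \<noteq> 0" using rz[of p] p by auto
    have comp: "v $ p * w1 $ p = \<alpha> * c3 $ p" "r $ p * w1 $ p = \<beta> * c2 $ p"
      "r $ p * w2 $ p = \<gamma> * c1 $ p" "u $ p * w2 $ p = \<delta> * c3 $ p"
      using \<alpha>(2) \<beta>(2) \<gamma>(2) \<delta>(2) by (metis vector_mult_component vector_smult_component)+
    have "u $ p * (\<gamma> * c1 $ p) = r $ p * (\<delta> * c3 $ p)" "v $ p * (\<beta> * c2 $ p) = r $ p * (\<alpha> * c3 $ p)"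
      unfolding comp[symmetric] by (simp_all add: mult_ac)
    then have uv: "u $ p = r $ p * (\<delta> * c3 $ p) / (\<gamma> * c1 $ p)"
      "v $ p = r $ p * (\<alpha> * c3 $ p) / (\<beta> * c2 $ p)"
      using nz1 \<beta> \<gamma> by (simp_all add: eq_divide_eq)
    have "r $ p = A * u $ p + B * v $ p" by (simp add: r_eq)
    also have "\<dots> = r $ p * c3 $ p * (\<rho> / c1 $ p + \<mu> / c2 $ p)"
      unfolding uv \<rho>_def \<mu>_def by (simp add: algebra_simps)
    finally show ?thesis using nz1 nz2 by (simp add: divide_eq_eq mult_ac)
  qed
  then show ?thesis by blast
qed

section \<open>Words dual to an information set and their reciprocals\<close>

lemma interpolating_words:
  assumes crit: "critical S d C D" and T: "T \<subseteq> S" "card T = vec.dim C"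
  obtains c where "\<And>t. t \<in> T \<Longrightarrow> c t \<in> C"
    "\<And>s t. s \<in> T \<Longrightarrow> t \<in> T \<Longrightarrow> c t $ s = (if s = t then 1 else 0)"
proof -
  have C: "vec.subspace C" using crit by (simp add: critical_def)
  have "\<exists>x\<in>C. \<forall>s\<in>T. x $ s = (if s = t then 1 else 0)" if t: "t \<in> T" for t
  proof -
    have "card (T - {t}) < vec.dim C" using t T(2) by (metis card_Diff1_less finite)
    then obtain x where x: "x \<in> C" "x \<noteq> 0" "\<And>i. i \<in> T - {t} \<Longrightarrow> x $ i = 0"
      using ex_nonzero_vanishing[OF C] by blast
    have "x $ t \<noteq> 0"
      using critical_zeros[OF crit x(1) _ T(1)] x T(2) by fastforce
    then have "\<forall>s\<in>T. ((1 / x $ t) *s x) $ s = (if s = t then 1 else 0)" using x by auto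
    then show ?thesis using vec.subspace_scale[OF C x(1)] by blast
  qed
  then show ?thesis using that by metis
qed

text \<open>Reduction to \<open>critical_3_2\<close>: shorten \<open>C\<close> at
  \<open>T - {t1, t2, t3}\<close> and \<open>D\<close> at \<open>vec.dim D - 2\<close> coordinates
  outside \<open>T\<close> and \<open>Q\<close>. As \<open>card (S - T) = vec.dim D + d - 2\<close>
  and \<open>3 \<le> d\<close>, there is room for this when \<open>card Q \<le> 3\<close>, and
  \<open>Q\<close> survives both shortenings.\<close>

lemma reciprocals_dependent_local:
  fixes C D :: "('a::field ^ 'n) set"
  assumes crit: "critical S d C D" and l: "2 \<le> vec.dim D"
    and T: "T \<subseteq> S" "card T = vec.dim C"
    and c: "\<And>t. t \<in> T \<Longrightarrow> c t \<in> C"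
      "\<And>s t. s \<in> T \<Longrightarrow> t \<in> T \<Longrightarrow> c t $ s = (if s = t then 1 else 0)"
    and t: "t1 \<in> T" "t2 \<in> T" "t3 \<in> T" "t1 \<noteq> t2" "t1 \<noteq> t3" "t2 \<noteq> t3"
    and Q: "Q \<subseteq> S - T" "card Q \<le> 3"
  shows "\<exists>\<rho> \<mu>. \<forall>p\<in>Q. 1 / c t3 $ p = \<rho> / c t1 $ p + \<mu> / c t2 $ p"
proof -
  define J where "J = T - {t1, t2, t3}"
  have t3: "{t1, t2, t3} \<subseteq> T" "card {t1, t2, t3} = 3" using t by auto
  have "3 \<le> vec.dim C" using t3 T(2) card_mono[OF finite t3(1)] by simp
  then have cJ: "card J = vec.dim C - 3" "card J < vec.dim C"
    using t3 T(2) by (simp_all add: J_def card_Diff_subset)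
  have "J \<subseteq> S" using T by (auto simp: J_def)
  note 1 = critical_shorten_set[OF crit this cJ(2)]
  let ?C = "shorten J C" and ?D = "(*) (mask (S - J)) ` D"
  have dims: "vec.dim ?C = 3" "vec.dim ?D = vec.dim D" using 1 cJ \<open>3 \<le> vec.dim C\<close> by auto
  have "card (S - T) = card S - vec.dim C" using T by (simp add: card_Diff_subset)
  then have "vec.dim D - 2 \<le> card (S - T) - card Q"
    using critical_card[OF crit] Q(2) l by linarith
  also have "\<dots> = card (S - T - Q)" using Q(1) by (simp add: card_Diff_subset)
  finally obtain J' where J': "J' \<subseteq> S - T - Q" "card J' = vec.dim D - 2"
    by (meson obtain_subset_with_card_n)
  have J'2: "J' \<subseteq> S - J" "card J' < vec.dim ?D" using J' dims l by (auto simp: J_def)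
  note 2 = critical_shorten_set[OF critical_commute[OF 1[THEN conjunct1]] J'2]
  let ?S = "S - J - J'"
  let ?C' = "(*) (mask ?S) ` ?C" and ?D' = "shorten J' ?D"
  have crit': "critical ?S d ?C' ?D'" "vec.dim ?C' = 3" "vec.dim ?D' = 2"
    using 2 dims J' l by (auto intro: critical_commute)
  have "mask ?S * c t \<in> ?C'" if "t \<in> {t1, t2, t3}" for t
    using that c t by (auto simp: shorten_def J_def)
  moreover have "t \<in> ?S" if "t \<in> {t1, t2, t3}" for t
    using that t T J' by (auto simp: J_def)
  moreover have "(mask ?S * c s) $ t = (if s = t then 1 else 0)"
    if "s \<in> {t1, t2, t3}" "t \<in> {t1, t2, t3}" for s t
    using that c(2)[of t s] t T J' by (auto simp: J_def)
  ultimately have "\<exists>\<rho> \<mu>. \<forall>p\<in>?S - {t1, t2, t3}. 1 / (mask ?S * c t3) $ p =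
      \<rho> / (mask ?S * c t1) $ p + \<mu> / (mask ?S * c t2) $ p"
    using t by (intro critical_3_2[OF crit']) auto
  then obtain \<rho> \<mu> where *: "\<And>p. p \<in> ?S - {t1, t2, t3} \<Longrightarrow> 1 / (mask ?S * c t3) $ p =
      \<rho> / (mask ?S * c t1) $ p + \<mu> / (mask ?S * c t2) $ p" by blast
  have "1 / c t3 $ p = \<rho> / c t1 $ p + \<mu> / c t2 $ p" if "p \<in> Q" for p
  proof -
    have "p \<in> ?S - {t1, t2, t3}" using that Q J' t3(1) by (auto simp: J_def)
    then show ?thesis using *[of p] by simp
  qed
  then show ?thesis by blast
qed

lemma interpolating_words_nonzero:
  assumes crit: "critical S d C D" and T: "T \<subseteq> S" "card T = vec.dim C"
    and c: "\<And>t. t \<in> T \<Longrightarrow> c t \<in> C"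
      "\<And>s t. s \<in> T \<Longrightarrow> t \<in> T \<Longrightarrow> c t $ s = (if s = t then 1 else 0)"
    and t: "t \<in> T" and p: "p \<in> S - T"
  shows "c t $ p \<noteq> 0"
proof
  assume "c t $ p = 0"
  moreover have "card T = Suc (card (T - {t}))" using t by (metis card_Suc_Diff1 finite)
  then have "vec.dim C \<le> card (insert p (T - {t}))" using T(2) p by simp
  ultimately have "c t = 0"
    using c t p T(1) by (intro critical_zeros[OF crit c(1)[OF t], of "insert p (T - {t})"]) auto
  then show False using c(2)[OF t t] by simp
qed

text \<open>The 2x2 minors of \<open>A\<close> in the generator matrix \<open>[I | A]\<close>. The
  combination \<open>x\<close> cancels at \<open>p\<close>, and also at \<open>q\<close> if the
  minor is 0; it then has \<open>vec.dim C\<close> zeros, yet it is nonzero at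
  \<open>s\<close>.\<close>

lemma interpolating_words_minor:
  assumes crit: "critical S d C D" and T: "T \<subseteq> S" "card T = vec.dim C"
    and c: "\<And>t. t \<in> T \<Longrightarrow> c t \<in> C"
      "\<And>s t. s \<in> T \<Longrightarrow> t \<in> T \<Longrightarrow> c t $ s = (if s = t then 1 else 0)"
    and t: "s \<in> T" "t \<in> T" "s \<noteq> t" and p: "p \<in> S - T" "q \<in> S - T" "p \<noteq> q"
  shows "c s $ p * c t $ q \<noteq> c s $ q * c t $ p"
proof
  assume eq: "c s $ p * c t $ q = c s $ q * c t $ p"
  define x where "x = c t $ p *s c s - c s $ p *s c t"
  have C: "vec.subspace C" using crit by (simp add: critical_def)
  have "x \<in> C" using c t C by (auto simp: x_def intro!: vec.subspace_diff vec.subspace_scale)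
  moreover have "card T = Suc (Suc (card (T - {s, t})))"
    using t card_Diff_subset[of "{s, t}" T] card_mono[of T "{s, t}"] by simp
  then have "vec.dim C \<le> card (insert p (insert q (T - {s, t})))" using T(2) p by simp
  ultimately have "x = 0"
    using c t p T(1) eq
    by (intro critical_zeros[OF crit, of x "insert p (insert q (T - {s, t}))"])
      (auto simp: x_def mult_ac)
  then have "x $ s = 0" by simp
  then show False
    using c(2)[of s] t interpolating_words_nonzero[OF crit T c t(2) p(1)] by (simp add: x_def)
qed

text \<open>Local relations glue: by the nonvanishing minor the coefficients are determined at
  \<open>p\<close> and \<open>q\<close>, so the relations on \<open>{p, q}\<close> and on
  \<open>{p, q, x}\<close> share them for every \<open>x\<close>.\<close>

lemma reciprocals_dependent:
  fixes C D :: "('a::field ^ 'n) set"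
  assumes crit: "critical S d C D" and l: "2 \<le> vec.dim D"
    and T: "T \<subseteq> S" "card T = vec.dim C"
    and c: "\<And>t. t \<in> T \<Longrightarrow> c t \<in> C"
      "\<And>s t. s \<in> T \<Longrightarrow> t \<in> T \<Longrightarrow> c t $ s = (if s = t then 1 else 0)"
    and t: "t1 \<in> T" "t2 \<in> T" "t \<in> T" "t1 \<noteq> t2"
  shows "\<exists>\<rho> \<mu>. \<forall>p\<in>S - T. 1 / c t $ p = \<rho> / c t1 $ p + \<mu> / c t2 $ p"
proof -
  consider "t = t1" | "t = t2" | "t1 \<noteq> t" "t2 \<noteq> t" by auto
  then show ?thesis
  proof cases
    case 1
    then show ?thesis by (intro exI[of _ 1] exI[of _ 0]) simp
  next
    case 2
    then show ?thesis by (intro exI[of _ 0] exI[of _ 1]) simp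
  next
    case 3
    have "card (S - T) = card S - vec.dim C" using T by (simp add: card_Diff_subset)
    then have "2 \<le> card (S - T)" using critical_card[OF crit] l by linarith
    then obtain Q where "Q \<subseteq> S - T" "card Q = 2" by (meson obtain_subset_with_card_n)
    then obtain p q where pq: "p \<in> S - T" "q \<in> S - T" "p \<noteq> q"
      by (auto simp: card_2_iff)
    note local = reciprocals_dependent_local[OF crit l T c t(1,2,3,4) 3]
    note nz = interpolating_words_nonzero[OF crit T c]
    have nz': "c t1 $ p \<noteq> 0" "c t2 $ p \<noteq> 0" "c t1 $ q \<noteq> 0" "c t2 $ q \<noteq> 0"
      using nz t pq by auto
    have minor: "c t1 $ p * c t2 $ q \<noteq> c t1 $ q * c t2 $ p"
      by (rule interpolating_words_minor[OF crit T c]) (use t pq in auto)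
    obtain \<rho> \<mu> where lm: "\<forall>x\<in>{p, q}. 1 / c t $ x = \<rho> / c t1 $ x + \<mu> / c t2 $ x"
      using local[of "{p, q}"] pq by auto
    have "1 / c t $ x = \<rho> / c t1 $ x + \<mu> / c t2 $ x" if x: "x \<in> S - T" for x
    proof -
      have "card {p, q, x} \<le> 3" by (simp add: card_insert_if)
      then obtain \<rho>' \<mu>' where lm': "\<forall>x\<in>{p, q, x}. 1 / c t $ x = \<rho>' / c t1 $ x + \<mu>' / c t2 $ x"
        using local[of "{p, q, x}"] pq x by auto
      have "\<rho> / c t1 $ y + \<mu> / c t2 $ y = \<rho>' / c t1 $ y + \<mu>' / c t2 $ y" if "y \<in> {p, q}" for y
        using lm lm' that by (metis insert_iff)
      then have "(\<rho> - \<rho>') / c t1 $ y + (\<mu> - \<mu>') / c t2 $ y = 0" if "y \<in> {p, q}" for y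
        using that by (simp add: diff_divide_distrib algebra_simps)
      from this[of p] this[of q]
      have "(\<rho> - \<rho>') / c t1 $ p + (\<mu> - \<mu>') / c t2 $ p = 0"
        "(\<rho> - \<rho>') / c t1 $ q + (\<mu> - \<mu>') / c t2 $ q = 0" by simp_all
      then have e: "(\<rho> - \<rho>') * c t2 $ p = - (\<mu> - \<mu>') * c t1 $ p"
        "(\<rho> - \<rho>') * c t2 $ q = - (\<mu> - \<mu>') * c t1 $ q"
        using nz' by (simp_all add: field_simps)
      have "(\<rho> - \<rho>') * (c t1 $ p * c t2 $ q - c t1 $ q * c t2 $ p) =
          c t1 $ p * ((\<rho> - \<rho>') * c t2 $ q) - c t1 $ q * ((\<rho> - \<rho>') * c t2 $ p)"
        by (simp add: algebra_simps)
      also have "\<dots> = 0" unfolding e by (simp add: algebra_simps)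
      finally have "\<rho> = \<rho>'" using minor by simp
      moreover from this have "\<mu> = \<mu>'" using e(1) nz' by simp
      ultimately show ?thesis using lm' by simp
    qed
    then show ?thesis by blast
  qed
qed

subsection \<open>Reed-Solomon codes\<close>

definition ev_word :: "nat \<Rightarrow> ('n \<Rightarrow> 'a::field eval_point) \<Rightarrow> 'a poly \<Rightarrow> 'a ^ 'n" where
  "ev_word k \<alpha> f = (\<chi> i. eval_at k f (\<alpha> i))"

text \<open>
  Homogeneous coordinates \<open>(U\<^sub>i : V\<^sub>i)\<close> of the evaluation points: multiplication by \<open>U\<close> is
  multiplication of polynomials by \<open>X\<close>, and multiplication by \<open>V\<close> is the passage from degree
  bound \<open>k\<close> to degree bound \<open>k + 1\<close>.
\<close>

definition point_U :: "('n \<Rightarrow> 'a::field eval_point) \<Rightarrow> 'a ^ 'n" where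
  "point_U \<alpha> = (\<chi> i. case \<alpha> i of Finite_Point a \<Rightarrow> a | Infinity_Point \<Rightarrow> 1)"

definition point_V :: "('n \<Rightarrow> 'a::field eval_point) \<Rightarrow> 'a ^ 'n" where
  "point_V \<alpha> = (\<chi> i. case \<alpha> i of Finite_Point a \<Rightarrow> 1 | Infinity_Point \<Rightarrow> 0)"

lemma degree_less_iff: "f = 0 \<or> degree f < k \<longleftrightarrow> (\<forall>m\<ge>k. coeff f m = 0)"
proof
  assume "\<forall>m\<ge>k. coeff f m = 0"
  then have "k \<le> degree f \<longrightarrow> f = 0" by (metis leading_coeff_0_iff)
  then show "f = 0 \<or> degree f < k" by linarith
qed (auto simp: coeff_eq_0)

lemma RS_code_altdef:
  "RS_code k g \<alpha> = {g * ev_word k \<alpha> f |f. \<forall>m\<ge>k. coeff f m = 0}"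
  unfolding RS_code_def degree_less_iff by (simp add: ev_word_def times_vec_def)

lemma ev_word_add: "ev_word k \<alpha> (f + h) = ev_word k \<alpha> f + ev_word k \<alpha> h"
proof -
  have "eval_at k (f + h) p = eval_at k f p + eval_at k h p" for p
    by (cases p) auto
  then show ?thesis by (simp add: ev_word_def vec_eq_iff)
qed

lemma ev_word_smult: "ev_word k \<alpha> (smult a f) = a *s ev_word k \<alpha> f"
proof -
  have "eval_at k (smult a f) p = a * eval_at k f p" for p
    by (cases p) auto
  then show ?thesis by (simp add: ev_word_def vec_eq_iff)
qed

lemma ev_word_0 [simp]: "ev_word k \<alpha> 0 = 0"
  using ev_word_smult[of k \<alpha> 0 0] by simp

lemma ev_word_pCons:
  assumes "0 < k"
  shows "ev_word (Suc k) \<alpha> (pCons 0 f) = point_U \<alpha> * ev_word k \<alpha> f"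
proof -
  have "coeff (pCons 0 f) k = coeff f (k - 1)" using assms by (cases k) auto
  then show ?thesis
    by (auto simp: ev_word_def point_U_def vec_eq_iff split: eval_point.split)
qed

lemma ev_word_Suc:
  assumes "\<forall>m\<ge>k. coeff f m = 0"
  shows "ev_word (Suc k) \<alpha> f = point_V \<alpha> * ev_word k \<alpha> f"
  using assms by (auto simp: ev_word_def point_V_def vec_eq_iff split: eval_point.split)

text \<open>In the coefficient at \<open>k + l\<close> only the term \<open>i = k\<close> survives;
  this makes evaluation at infinity, taken with formal degrees, multiplicative.\<close>

lemma coeff_mult_bound:
  assumes "\<forall>m\<ge>Suc k. coeff f m = 0" "\<forall>m\<ge>Suc l. coeff h m = 0"
  shows "coeff (f * h) (k + l) = coeff f k * coeff h l" "m \<ge> Suc (k + l) \<Longrightarrow> coeff (f * h) m = 0"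
proof -
  have 0: "coeff f i * coeff h (m - i) = 0" if "k + l \<le> m" "m \<noteq> k + l \<or> i \<noteq> k" for i m
  proof (cases "Suc k \<le> i")
    case False
    then have "Suc l \<le> m - i" using that by linarith
    then show ?thesis using assms(2) by simp
  qed (use assms(1) in simp)
  have "coeff (f * h) (k + l) = coeff f k * coeff h (k + l - k) +
      (\<Sum>i\<in>{..k + l} - {k}. coeff f i * coeff h (k + l - i))"
    unfolding coeff_mult by (rule sum.remove) auto
  also have "(\<Sum>i\<in>{..k + l} - {k}. coeff f i * coeff h (k + l - i)) = 0"
    by (intro sum.neutral ballI 0) auto
  finally show "coeff (f * h) (k + l) = coeff f k * coeff h l" by simp
  show "coeff (f * h) m = 0" if "m \<ge> Suc (k + l)"
    unfolding coeff_mult using that by (intro sum.neutral ballI 0) auto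
qed

lemma eval_at_mult:
  assumes "\<forall>m\<ge>Suc k. coeff f m = 0" "\<forall>m\<ge>Suc l. coeff h m = 0"
  shows "eval_at (Suc (k + l)) (f * h) p = eval_at (Suc k) f p * eval_at (Suc l) h p"
  using coeff_mult_bound(1)[OF assms] by (cases p) auto

text \<open>The factors have formal degree 1, hence the 2 in \<open>eval_at 2\<close>;
  \<open>a s\<close> may be 0, which puts the root at infinity.\<close>

lemma eval_at_prod_linear:
  assumes "finite A"
  shows "(\<forall>m\<ge>Suc (card A). coeff (\<Prod>s\<in>A. [:b s, a s:]) m = 0) \<and>
    eval_at (Suc (card A)) (\<Prod>s\<in>A. [:b s, a s:]) p = (\<Prod>s\<in>A. eval_at 2 [:b s, a s:] p)"
  using assms
proof (induction A rule: finite_induct)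
  case empty
  show ?case by (cases p) auto
next
  case (insert x A)
  have 1: "\<forall>m\<ge>Suc 1. coeff [:b x, a x:] m = 0"
    by (metis One_nat_def Suc_le_D coeff_pCons_Suc coeff_0 Suc_le_mono)
  have 2: "\<forall>m\<ge>Suc (card A). coeff (\<Prod>s\<in>A. [:b s, a s:]) m = 0" using insert.IH by blast
  have "eval_at (Suc 1) [:b x, a x:] p = eval_at 2 [:b x, a x:] p" by (simp add: numeral_2_eq_2)
  then show ?case
    using insert eval_at_mult[OF 1 2, of p] coeff_mult_bound(2)[OF 1 2] by simp
qed

lemma subspace_RS_code: "vec.subspace (RS_code k g \<alpha> :: ('a::field ^ 'n) set)"
proof (rule vec.subspaceI)
  show "0 \<in> RS_code k g \<alpha>"
    unfolding RS_code_altdef by (auto intro!: exI[of _ 0])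
next
  fix x y :: "'a ^ 'n" assume "x \<in> RS_code k g \<alpha>" "y \<in> RS_code k g \<alpha>"
  then obtain f h where "x = g * ev_word k \<alpha> f" "y = g * ev_word k \<alpha> h"
    "\<forall>m\<ge>k. coeff f m = 0" "\<forall>m\<ge>k. coeff h m = 0" unfolding RS_code_altdef by auto
  then show "x + y \<in> RS_code k g \<alpha>"
    unfolding RS_code_altdef
    by (auto intro!: exI[of _ "f + h"] simp: ev_word_add distrib_left)
next
  fix c and x :: "'a ^ 'n" assume "x \<in> RS_code k g \<alpha>"
  then obtain f where "x = g * ev_word k \<alpha> f" "\<forall>m\<ge>k. coeff f m = 0"
    unfolding RS_code_altdef by auto
  then show "c *s x \<in> RS_code k g \<alpha>"
    unfolding RS_code_altdef
    by (auto intro!: exI[of _ "smult c f"] simp: ev_word_smult vec_eq_iff)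
qed

text \<open>Splitting off the top coefficient: the larger code lies in the span of
  \<open>point_V \<alpha>\<close> times the smaller one and the evaluation of
  \<open>X^k\<close>.\<close>

lemma dim_RS_code_Suc: "vec.dim (RS_code (Suc k) g \<alpha>) \<le> Suc (vec.dim (RS_code k g \<alpha>))"
proof -
  let ?V = "(*) (point_V \<alpha>) ` RS_code k g \<alpha>" and ?m = "g * ev_word (Suc k) \<alpha> (monom 1 k)"
  have "RS_code (Suc k) g \<alpha> \<subseteq> vec.span (insert ?m ?V)"
  proof
    fix x assume "x \<in> RS_code (Suc k) g \<alpha>"
    then obtain f where f: "x = g * ev_word (Suc k) \<alpha> f" "\<forall>m\<ge>Suc k. coeff f m = 0"
      unfolding RS_code_altdef by auto
    define h where "h = f - smult (coeff f k) (monom 1 k)"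
    have h: "\<forall>m\<ge>k. coeff h m = 0"
    proof (intro allI impI)
      fix m assume "k \<le> m"
      then show "coeff h m = 0"
        using f(2) by (cases "m = k") (auto simp: h_def)
    qed
    have "f = smult (coeff f k) (monom 1 k) + h" by (simp add: h_def)
    then have "ev_word (Suc k) \<alpha> f =
        coeff f k *s ev_word (Suc k) \<alpha> (monom 1 k) + point_V \<alpha> * ev_word k \<alpha> h"
      by (metis ev_word_add ev_word_smult ev_word_Suc[OF h])
    then have "x = coeff f k *s ?m + point_V \<alpha> * (g * ev_word k \<alpha> h)"
      by (simp add: f(1) vec_eq_iff algebra_simps)
    moreover have "point_V \<alpha> * (g * ev_word k \<alpha> h) \<in> ?V"
      using h unfolding RS_code_altdef by blast
    ultimately show "x \<in> vec.span (insert ?m ?V)"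
      by (auto intro!: vec.span_add vec.span_scale intro: vec.span_base)
  qed
  then have "vec.dim (RS_code (Suc k) g \<alpha>) \<le> vec.dim (insert ?m ?V)" by (rule vec.dim_mono)
  also have "\<dots> \<le> Suc (vec.dim ?V)" by (simp add: vec.dim_insert)
  also have "vec.dim ?V \<le> vec.dim (RS_code k g \<alpha>)" by (rule vec.dim_image_le[OF linear_times])
  finally show ?thesis by simp
qed

lemma dim_RS_code_le: "vec.dim (RS_code k (g :: 'a::field ^ 'b) \<alpha>) \<le> k"
proof (induction k)
  case 0
  have "f = 0" if "\<forall>m\<ge>0. coeff f m = 0" for f :: "'a poly"
    using that by (simp add: poly_eq_iff)
  then have "RS_code 0 g \<alpha> \<subseteq> {0}" by (fastforce simp: RS_code_altdef)
  then have "vec.dim (RS_code 0 g \<alpha>) \<le> vec.dim {0 :: 'a ^ 'b}" by (rule vec.dim_subset)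
  then show ?case by simp
next
  case (Suc k)
  then show ?case using dim_RS_code_Suc[of k g \<alpha>] by linarith
qed

lemma RS_code_times_mem:
  assumes "x \<in> RS_code k g \<alpha>" "0 < k"
  shows "point_U \<alpha> * x \<in> RS_code (Suc k) g \<alpha>" "point_V \<alpha> * x \<in> RS_code (Suc k) g \<alpha>"
proof -
  obtain f where f: "x = g * ev_word k \<alpha> f" "\<forall>m\<ge>k. coeff f m = 0"
    using assms(1) unfolding RS_code_altdef by auto
  have "point_U \<alpha> * x = g * ev_word (Suc k) \<alpha> (pCons 0 f)"
    using f assms(2) by (simp add: ev_word_pCons mult_ac)
  moreover have "\<forall>m\<ge>Suc k. coeff (pCons 0 f) m = 0"
    using f(2) by (auto simp: coeff_pCons split: nat.split)
  ultimately show "point_U \<alpha> * x \<in> RS_code (Suc k) g \<alpha>" unfolding RS_code_altdef by blast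
  have "point_V \<alpha> * x = g * ev_word (Suc k) \<alpha> f"
    using f by (simp add: ev_word_Suc mult_ac)
  then show "point_V \<alpha> * x \<in> RS_code (Suc k) g \<alpha>" using f(2) unfolding RS_code_altdef by force
qed

lemma RS_code_prod_subset:
  "code_prod (RS_code (Suc k) g \<alpha>) (RS_code (Suc l) h \<alpha>) \<subseteq> RS_code (Suc (k + l)) (g * h) \<alpha>"
proof (rule code_prod_least[OF subspace_RS_code])
  fix x y assume "x \<in> RS_code (Suc k) g \<alpha>" "y \<in> RS_code (Suc l) h \<alpha>"
  then obtain p q where pq: "x = g * ev_word (Suc k) \<alpha> p" "y = h * ev_word (Suc l) \<alpha> q"
    "\<forall>m\<ge>Suc k. coeff p m = 0" "\<forall>m\<ge>Suc l. coeff q m = 0"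
    unfolding RS_code_altdef by auto
  have "x * y = g * h * ev_word (Suc (k + l)) \<alpha> (p * q)"
    unfolding pq(1,2) by (simp add: vec_eq_iff ev_word_def eval_at_mult[OF pq(3,4)])
  then show "x * y \<in> RS_code (Suc (k + l)) (g * h) \<alpha>"
    using coeff_mult_bound(2)[OF pq(3,4)] unfolding RS_code_altdef by blast
qed

lemma RS_code_support:
  fixes g :: "'a::field ^ 'n"
  assumes "\<forall>i. g $ i \<noteq> 0"
  shows "code_support (RS_code (Suc k) g \<alpha>) = UNIV"
proof -
  have "\<exists>x\<in>RS_code (Suc k) g \<alpha>. x $ i \<noteq> 0" for i
  proof -
    define f :: "'a poly" where "f = (case \<alpha> i of Finite_Point a \<Rightarrow> 1 | Infinity_Point \<Rightarrow> monom 1 k)"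
    have "\<forall>m\<ge>Suc k. coeff f m = 0" by (auto simp: f_def coeff_monom split: eval_point.split)
    then have "g * ev_word (Suc k) \<alpha> f \<in> RS_code (Suc k) g \<alpha>" unfolding RS_code_altdef by blast
    moreover have "(g * ev_word (Suc k) \<alpha> f) $ i \<noteq> 0"
      using assms by (auto simp: f_def ev_word_def split: eval_point.split)
    ultimately show ?thesis by blast
  qed
  then show ?thesis by (auto simp: code_support_def)
qed

lemma RS_code_multiplier_nonzero:
  assumes "code_support (RS_code k g \<alpha>) = UNIV"
  shows "g $ i \<noteq> 0"
proof -
  have "i \<in> code_support (RS_code k g \<alpha>)" using assms by simp
  then show ?thesis by (auto simp: code_support_def RS_code_altdef)
qed

lemma point_independent:
  assumes "inj \<alpha>" "i \<noteq> j"
  shows "point_U \<alpha> $ i * point_V \<alpha> $ j \<noteq> point_V \<alpha> $ i * point_U \<alpha> $ j"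
  using assms inj_eq[OF assms(1), of i j]
  by (cases "\<alpha> i"; cases "\<alpha> j") (auto simp: point_U_def point_V_def)

lemma point_nonzero: "point_U \<alpha> $ i \<noteq> 0 \<or> point_V \<alpha> $ i \<noteq> 0"
  by (cases "\<alpha> i") (auto simp: point_U_def point_V_def)

section \<open>Recognising Reed-Solomon codes by their pencil sums\<close>

lemma inj_on_times:
  fixes C :: "('a::field ^ 'n) set"
  assumes C: "vec.subspace C" and w: "min_weight_ge 2 C" and m: "\<And>j. j \<noteq> i \<Longrightarrow> m $ j \<noteq> 0"
  shows "inj_on ((*) m) C"
proof (rule inj_onI)
  fix x y assume xy: "x \<in> C" "y \<in> C" "m * x = m * y"
  have "(x - y) $ j = 0" if "j \<noteq> i" for j
  proof -
    have "m $ j * x $ j = m $ j * y $ j" using xy(3) by (metis vector_mult_component)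
    then show ?thesis using m[OF that] by simp
  qed
  then have "hamming_weight (x - y) \<le> card {i}" by (intro hamming_weight_le) auto
  then show "x = y"
    using w vec.subspace_diff[OF C xy(1,2)] by (fastforce simp: min_weight_ge_def)
qed

definition pencil_sum :: "'a::field ^ 'n \<Rightarrow> 'a ^ 'n \<Rightarrow> ('a ^ 'n) set \<Rightarrow> ('a ^ 'n) set" where
  "pencil_sum u v C = {u * x + v * y |x y. x \<in> C \<and> y \<in> C}"

lemma subspace_pencil_sum: "vec.subspace C \<Longrightarrow> vec.subspace (pencil_sum u v C)"
proof -
  assume C: "vec.subspace C"
  have "pencil_sum u v C = {x + y |x y. x \<in> (*) u ` C \<and> y \<in> (*) v ` C}"
    unfolding pencil_sum_def by blast
  then show ?thesis
    using vec.subspace_sums[OF subspace_times_image[OF C, of u] subspace_times_image[OF C, of v]]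
    by simp
qed

text \<open>The member \<open>m\<close> of the pencil vanishes exactly at \<open>i\<close>, so
  \<open>m * C\<close> is a copy of \<open>C\<close> among words with a zero at \<open>i\<close>;
  \<open>z\<close> is nonzero there and adds a dimension.\<close>

lemma dim_pencil_sum:
  fixes C :: "('a::field ^ 'n) set"
  assumes \<alpha>: "inj \<alpha>" and C: "vec.subspace C" and w: "min_weight_ge 2 C" and nz: "vec.dim C \<noteq> 0"
  shows "Suc (vec.dim C) \<le> vec.dim (pencil_sum (point_U \<alpha>) (point_V \<alpha>) C)"
proof -
  obtain c where "c \<in> C" "c \<noteq> 0" using nz by (rule dim_nonzeroE)
  then obtain i where c: "c \<in> C" "c $ i \<noteq> 0" by (auto simp: vec_eq_iff)
  let ?P = "pencil_sum (point_U \<alpha>) (point_V \<alpha>) C"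
  define m where "m = point_U \<alpha> $ i *s point_V \<alpha> - point_V \<alpha> $ i *s point_U \<alpha>"
  have m: "m $ i = 0" "\<And>j. j \<noteq> i \<Longrightarrow> m $ j \<noteq> 0"
    using point_independent[OF \<alpha>, of i] by (auto simp: m_def)
  define z where "z = (if point_U \<alpha> $ i \<noteq> 0 then point_U \<alpha> * c else point_V \<alpha> * c)"
  have z: "z $ i \<noteq> 0" using c(2) point_nonzero[of \<alpha> i] by (auto simp: z_def)
  have in_P: "point_U \<alpha> * x + point_V \<alpha> * y \<in> ?P" if "x \<in> C" "y \<in> C" for x y
    using that by (auto simp: pencil_sum_def)
  have "z \<in> ?P"
    using in_P[OF c(1) vec.subspace_0[OF C]] in_P[OF vec.subspace_0[OF C] c(1)] by (simp add: z_def)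
  moreover have "(*) m ` C \<subseteq> ?P"
  proof clarify
    fix x assume x: "x \<in> C"
    have "m * x = point_U \<alpha> * ((- point_V \<alpha> $ i) *s x) + point_V \<alpha> * (point_U \<alpha> $ i *s x)"
      by (simp add: m_def vec_eq_iff algebra_simps)
    then show "m * x \<in> ?P" using in_P vec.subspace_scale[OF C x] by metis
  qed
  ultimately have "vec.dim (insert z ((*) m ` C)) \<le> vec.dim ?P" by (intro vec.dim_subset) auto
  moreover have span: "vec.span ((*) m ` C) = (*) m ` C"
    using subspace_times_image[OF C] by (simp add: vec.span_eq_iff)
  have "z \<notin> vec.span ((*) m ` C)" unfolding span using z m(1) by auto
  moreover have "vec.dim ((*) m ` C) = vec.dim C"
    using inj_on_times[OF C w m(2)] C by (intro vec.dim_image_eq linear_times)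
      (simp add: vec.span_eq_iff[THEN iffD2])
  ultimately show ?thesis by (simp add: vec.dim_insert)
qed

text \<open>
  If \<open>C = RS\<^sub>k\<close> and \<open>k \<ge> 2\<close>, then the words \<open>w\<close> with \<open>Uw \<in> C\<close> and \<open>Vw \<in> C\<close> form \<open>RS\<^sub>k\<^sub>-\<^sub>1\<close>; in
  general the dimension of this quotient is forced, so that induction applies to it.
\<close>

lemma RS_code_if_pencil_sum_small:
  fixes C :: "('a::field ^ 'n) set"
  assumes "inj \<alpha>" and "vec.subspace C" and "min_weight_ge 2 C" and "vec.dim C = Suc k"
    and "vec.dim (pencil_sum (point_U \<alpha>) (point_V \<alpha>) C) \<le> Suc (Suc k)"
  shows "\<exists>g. C = RS_code (Suc k) g \<alpha>"
  using assms(2-)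
proof (induction k arbitrary: C)
  case 0
  obtain g where g: "g \<in> C" "g \<noteq> 0" using 0(3) by (metis dim_nonzeroE nat.simps(3))
  \<comment> \<open>With one coefficient, evaluation at any point, infinity included, reads off the
    constant term, so the code is the line through \<open>g\<close>.\<close>
  have sub: "RS_code 1 g \<alpha> \<subseteq> C"
  proof
    fix x assume "x \<in> RS_code 1 g \<alpha>"
    then obtain f where f: "x = g * ev_word 1 \<alpha> f" "\<forall>m\<ge>1. coeff f m = 0"
      unfolding RS_code_altdef by auto
    then have "degree f = 0" by (metis leading_coeff_0_iff less_one not_le degree_0)
    then have "eval_at 1 f p = coeff f 0" for p by (cases p) (auto elim!: degree_eq_zeroE)
    then have "x = coeff f 0 *s g" by (simp add: f ev_word_def vec_eq_iff)
    then show "x \<in> C" using g vec.subspace_scale[OF 0(1)] by simp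
  qed
  have "eval_at 1 (1 :: 'a poly) p = 1" for p by (cases p) auto
  then have "g = g * ev_word 1 \<alpha> 1" by (simp add: ev_word_def vec_eq_iff)
  moreover have "\<forall>m\<ge>1. coeff (1 :: 'a poly) m = 0" by simp
  ultimately have "g \<in> RS_code 1 g \<alpha>" unfolding RS_code_altdef by blast
  then have "vec.dim (RS_code 1 g \<alpha>) \<noteq> 0" using g by (intro dim_nonzeroI)
  then have "RS_code 1 g \<alpha> = C"
    using 0(1,3) sub by (intro vec.subspace_dim_equal subspace_RS_code) (auto simp del: vec.dim_eq_0)
  then show ?case by (metis One_nat_def)
next
  case (Suc k)
  let ?U = "point_U \<alpha>" and ?V = "point_V \<alpha>"
  define W where "W = {w. (\<forall>i. i \<notin> UNIV \<longrightarrow> w $ i = 0) \<and> ?U * w \<in> C \<and> ?V * w \<in> C}"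
  have inj: "inj_on ((*) u) C" if u: "u = ?U \<or> u = ?V" for u
  proof (cases "\<exists>i. u $ i = 0")
    case True
    then obtain i where "u $ i = 0" by blast
    then show ?thesis
      using u point_independent[OF assms(1), of i] point_nonzero[of \<alpha> i]
      by (intro inj_on_times[OF Suc.prems(1,2), of i]) auto
  next
    case False
    then show ?thesis by (intro inj_on_times[OF Suc.prems(1,2)]) auto
  qed
  have W: "vec.subspace W" and dW: "2 * vec.dim C \<le> vec.dim W + vec.dim (pencil_sum ?U ?V C)"
    unfolding W_def pencil_sum_def
    using dim_quotient_ge[OF Suc.prems(1) subset_UNIV point_nonzero[of \<alpha>]] inj by auto
  have dW: "Suc k \<le> vec.dim W" using dW Suc.prems(3,4) by linarith
  have "2 \<le> hamming_weight w" if w: "w \<in> W" "w \<noteq> 0" for w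
  proof -
    obtain i where "w $ i \<noteq> 0" using w(2) by (auto simp: vec_eq_iff)
    then obtain u where u: "u = ?U \<or> u = ?V" "u * w \<noteq> 0"
      using point_nonzero[of \<alpha> i] by (metis mult_eq_0_iff vector_mult_component zero_index)
    then have "2 \<le> hamming_weight (u * w)"
      using w Suc.prems(2) by (auto simp: W_def min_weight_ge_def)
    also have "\<dots> \<le> card {i. w $ i \<noteq> 0}" by (rule hamming_weight_le) simp
    finally show ?thesis by (simp add: hamming_weight_def)
  qed
  then have wW: "min_weight_ge 2 W" by (simp add: min_weight_ge_def)
  have sub: "pencil_sum ?U ?V W \<subseteq> C"
    using Suc.prems(1) by (auto simp: pencil_sum_def W_def intro: vec.subspace_add)
  then have "vec.dim (pencil_sum ?U ?V W) \<le> Suc (Suc k)"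
    using vec.dim_subset Suc.prems(3) by metis
  moreover have "Suc (vec.dim W) \<le> vec.dim (pencil_sum ?U ?V W)"
    using dW by (intro dim_pencil_sum[OF assms(1) W wW]) linarith
  \<comment> \<open>The lower bound from \<open>dim_quotient_ge\<close> and the inclusion of the
    pencil sum in \<open>C\<close> leave one value for each dimension. So induction applies to
    \<open>W\<close>, and its pencil sum fills \<open>C\<close>.\<close>
  ultimately have d: "vec.dim W = Suc k" "vec.dim (pencil_sum ?U ?V W) = Suc (Suc k)"
    using dW by linarith+
  then obtain g where g: "W = RS_code (Suc k) g \<alpha>"
    using Suc.IH[OF W wW] by auto
  have "pencil_sum ?U ?V W = C"
    using sub d Suc.prems(1,3) W by (intro vec.subspace_dim_equal subspace_pencil_sum) auto
  moreover have "pencil_sum ?U ?V W \<subseteq> RS_code (Suc (Suc k)) g \<alpha>"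
    unfolding pencil_sum_def g
    using RS_code_times_mem[of _ "Suc k" g \<alpha>]
    by (auto intro!: vec.subspace_add[OF subspace_RS_code])
  ultimately have "C = RS_code (Suc (Suc k)) g \<alpha>"
    using Suc.prems(1,3) dim_RS_code_le[of "Suc (Suc k)" g \<alpha>]
    by (intro vec.subspace_dim_equal subspace_RS_code) auto
  then show ?case by blast
qed

subsection \<open>Critical pairs are Reed-Solomon codes\<close>

text \<open>Coordinates with equal evaluation points carry proportional values, so no word separates
  them.\<close>

lemma RS_code_if_separating:
  assumes "C = RS_code k g \<alpha>" and "\<And>i j. i \<noteq> j \<Longrightarrow> \<exists>x\<in>C. x $ i = 0 \<and> x $ j \<noteq> 0"
    and "\<And>i. g $ i \<noteq> 0"
  shows "inj \<alpha>"
proof (rule injI, rule ccontr)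
  fix i j assume "\<alpha> i = \<alpha> j" "i \<noteq> j"
  then obtain x where "x \<in> C" "x $ i = 0" "x $ j \<noteq> 0" using assms(2) by blast
  then show False
    using assms(1,3) \<open>\<alpha> i = \<alpha> j\<close> by (auto simp: RS_code_altdef ev_word_def)
qed

text \<open>
  On the coordinates \<open>p \<notin> T\<close> all \<open>1 / c\<^sub>t\<close> are linear forms \<open>\<rho>\<^sub>t / c\<^sub>t\<^sub>1 + \<mu>\<^sub>t / c\<^sub>t\<^sub>2\<close>. Hence the
  evaluation point of \<open>p\<close> is \<open>c\<^sub>t\<^sub>2(p) / c\<^sub>t\<^sub>1(p)\<close>, that of \<open>t \<in> T\<close> is the root of \<open>\<rho>\<^sub>t X + \<mu>\<^sub>t\<close>, and
  \<open>c\<^sub>t\<close> is the evaluation of the product of all \<open>\<rho>\<^sub>s X + \<mu>\<^sub>s\<close> with \<open>s \<noteq> t\<close>.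
\<close>

lemma critical_RS_code:
  fixes C D :: "('a::field ^ 'n) set"
  assumes crit: "critical UNIV d C D" and k: "2 \<le> vec.dim C" and l: "2 \<le> vec.dim D"
  shows "\<exists>g \<alpha>. inj \<alpha> \<and> (\<forall>i. g $ i \<noteq> 0) \<and> C = RS_code (vec.dim C) g \<alpha>"
proof -
  have card: "vec.dim C + 2 \<le> CARD('n)" using critical_card[OF crit] l by simp
  then obtain T :: "'n set" where T: "card T = vec.dim C"
    by (metis obtain_subset_with_card_n le_add1 le_trans)
  have TS: "T \<subseteq> UNIV" by simp
  obtain c where c: "\<And>t. t \<in> T \<Longrightarrow> c t \<in> C"
    "\<And>s t. s \<in> T \<Longrightarrow> t \<in> T \<Longrightarrow> c t $ s = (if s = t then 1 else 0)"
    using interpolating_words[OF crit TS T] by blast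
  obtain t1 t2 where t: "t1 \<in> T" "t2 \<in> T" "t1 \<noteq> t2"
    using k T by (metis card_le_Suc0_iff_eq finite not_less_eq_eq numeral_2_eq_2)
  have nz: "c t $ p \<noteq> 0" if "t \<in> T" "p \<notin> T" for t p
    using interpolating_words_nonzero[OF crit TS T c that(1)] that(2) by simp
  obtain \<rho> \<mu> where rm: "\<And>t p. t \<in> T \<Longrightarrow> p \<notin> T \<Longrightarrow> 1 / c t $ p = \<rho> t / c t1 $ p + \<mu> t / c t2 $ p"
    using reciprocals_dependent[OF crit l TS T c t(1,2) _ t(3)] by (metis Diff_iff UNIV_I)
  have "2 \<le> card (UNIV - T)" using card T by (simp add: card_Diff_subset)
  then obtain p q where pq: "p \<notin> T" "q \<notin> T" "p \<noteq> q"
    by (metis Diff_iff card_le_Suc0_iff_eq finite not_less_eq_eq numeral_2_eq_2)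
  \<comment> \<open>The minor of \<open>1 / c s\<close>, \<open>1 / c t\<close> at \<open>p\<close>,
    \<open>q\<close> is that of the coefficients times that of \<open>1 / c t1\<close>,
    \<open>1 / c t2\<close>. Proportional coefficients would make it 0, against
    \<open>interpolating_words_minor\<close>.\<close>
  have indep: "\<rho> s * \<mu> t \<noteq> \<mu> s * \<rho> t" if st: "s \<in> T" "t \<in> T" "s \<noteq> t" for s t
  proof
    assume eq: "\<rho> s * \<mu> t = \<mu> s * \<rho> t"
    define a b where "a x = 1 / c t1 $ x" and "b x = 1 / c t2 $ x" for x
    have "1 / c s $ x * (1 / c t $ y) = (\<rho> s * a x + \<mu> s * b x) * (\<rho> t * a y + \<mu> t * b y)"
      if "x \<notin> T" "y \<notin> T" for x y
      using rm st that by (simp add: a_def b_def)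
    from this[OF pq(1,2)] this[OF pq(2,1)]
    have "1 / c s $ p * (1 / c t $ q) - 1 / c s $ q * (1 / c t $ p) =
        (\<rho> s * \<mu> t - \<mu> s * \<rho> t) * (a p * b q - b p * a q)"
      by (simp add: algebra_simps)
    then have "1 / c s $ p * (1 / c t $ q) = 1 / c s $ q * (1 / c t $ p)" using eq by simp
    then have "c s $ q * c t $ p = c s $ p * c t $ q"
      using nz st pq by (simp add: field_simps)
    then show False
      using interpolating_words_minor[OF crit TS T c st] pq by (auto simp: mult_ac)
  qed
  \<comment> \<open>With \<open>\<rho> i = 0\<close> the linear form is constant, and its projective
    root is infinity.\<close>
  define \<alpha> where "\<alpha> i = (if i \<in> T then if \<rho> i = 0 then Infinity_Point else Finite_Point (- \<mu> i / \<rho> i)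
      else Finite_Point (c t2 $ i / c t1 $ i))" for i
  define e where "e s i = eval_at 2 [:\<mu> s, \<rho> s:] (\<alpha> i)" for s i
  have e_P: "e s i = c t2 $ i / c s $ i" if "s \<in> T" "i \<notin> T" for s i
  proof -
    have "e s i = c t2 $ i * (\<rho> s / c t1 $ i + \<mu> s / c t2 $ i)"
      using that nz[OF t(2) that(2)] by (simp add: e_def \<alpha>_def distrib_left mult_ac)
    then show ?thesis unfolding rm[OF that, symmetric] by simp
  qed
  have e_self: "e s s = 0" if "s \<in> T" for s
    using that by (simp add: e_def \<alpha>_def)
  have e_T: "e s i \<noteq> 0" if "s \<in> T" "i \<in> T" "s \<noteq> i" for s i
  proof
    assume "e s i = 0"
    then have "\<rho> s * \<mu> i = \<mu> s * \<rho> i"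
      using that by (auto simp: e_def \<alpha>_def field_simps split: if_splits)
    then show False using indep[OF that] by simp
  qed
  \<comment> \<open>Chosen so that \<open>c r\<close> is \<open>g\<close> times the product of the
    \<open>e s\<close> with \<open>s \<noteq> r\<close>, for all \<open>r\<close> at once: on
    \<open>T\<close> it normalises the value at \<open>r\<close> to 1, off \<open>T\<close> it
    clears the factors \<open>c t2 / c s\<close>.\<close>
  define g where "g = (\<chi> i. if i \<in> T then 1 / (\<Prod>s\<in>T - {i}. e s i)
      else c t2 $ i * (\<Prod>s\<in>T. c s $ i / c t2 $ i))"
  have g: "g $ i \<noteq> 0" for i
    using e_T nz t by (auto simp: g_def)
  have c_eq: "c r = g * ev_word (vec.dim C) \<alpha> (\<Prod>s\<in>T - {r}. [:\<mu> s, \<rho> s:])"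
    and deg: "\<forall>m\<ge>vec.dim C. coeff (\<Prod>s\<in>T - {r}. [:\<mu> s, \<rho> s:]) m = 0" if r: "r \<in> T" for r
  proof -
    have sz: "Suc (card (T - {r})) = vec.dim C" using r T by (metis card_Suc_Diff1 finite)
    note prod = eval_at_prod_linear[of "T - {r}" \<mu> \<rho>, unfolded sz, OF finite]
    from prod show "\<forall>m\<ge>vec.dim C. coeff (\<Prod>s\<in>T - {r}. [:\<mu> s, \<rho> s:]) m = 0" by blast
    have "c r $ i = g $ i * (\<Prod>s\<in>T - {r}. e s i)" for i
    proof (cases "i \<in> T")
      case True
      show ?thesis
      proof (cases "i = r")
        case True
        then show ?thesis using c(2)[OF r r] e_T r by (simp add: g_def)
      next
        case False
        then have "(\<Prod>s\<in>T - {r}. e s i) = 0" using True e_self by auto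
        then show ?thesis using False c(2)[OF True r] by simp
      qed
    next
      case False
      have "(\<Prod>s\<in>T. c s $ i / c t2 $ i) = c r $ i / c t2 $ i * (\<Prod>s\<in>T - {r}. c s $ i / c t2 $ i)"
        using r by (intro prod.remove) auto
      moreover have "(\<Prod>s\<in>T - {r}. e s i) * (\<Prod>s\<in>T - {r}. c s $ i / c t2 $ i) = 1"
        unfolding prod.distrib[symmetric] using e_P[OF _ False] nz[OF _ False] t
        by (intro prod.neutral) auto
      ultimately show ?thesis
        using False nz[OF t(2) False] by (simp add: g_def) (metis mult.assoc mult.commute mult_1_right)
    qed
    then show "c r = g * ev_word (vec.dim C) \<alpha> (\<Prod>s\<in>T - {r}. [:\<mu> s, \<rho> s:])"
      using prod by (simp add: vec_eq_iff ev_word_def e_def)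
  qed
  let ?R = "RS_code (vec.dim C) g \<alpha>"
  have C: "vec.subspace C" using crit by (simp add: critical_def)
  have cR: "c r \<in> ?R" if "r \<in> T" for r
    using c_eq[OF that] deg[OF that] unfolding RS_code_altdef by blast
  have "C \<subseteq> ?R"
  proof
    fix x assume x: "x \<in> C"
    let ?y = "\<Sum>s\<in>T. x $ s *s c s"
    have "x - ?y = 0"
    proof (rule critical_zeros[OF crit])
      show "x - ?y \<in> C"
        using C x c(1) by (intro vec.subspace_diff vec.subspace_sum vec.subspace_scale) auto
      fix i assume i: "i \<in> T"
      have "?y $ i = (\<Sum>s\<in>T. if i = s then x $ s else 0)"
        unfolding sum_component by (rule sum.cong) (use c(2) i in auto)
      then show "(x - ?y) $ i = 0" using i by simp
    qed (use T in auto)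
    then have "x = ?y" by simp
    also have "?y \<in> ?R"
      using cR by (intro vec.subspace_sum vec.subspace_scale subspace_RS_code) auto
    finally show "x \<in> ?R" .
  qed
  then have eq: "C = ?R"
    using C dim_RS_code_le by (intro vec.subspace_dim_equal subspace_RS_code) auto
  moreover have "\<exists>x\<in>C. x $ i = 0 \<and> x $ j \<noteq> 0" if "i \<noteq> j" for i j
    using critical_separates[OF crit k _ _ that] by (metis UNIV_I)
  then have "inj \<alpha>" using RS_code_if_separating[OF eq _ g] by blast
  ultimately show ?thesis using g by blast
qed

text \<open>
  With \<open>C = RS\<^sub>k\<close>, the product \<open>RS\<^sub>k\<^sub>-\<^sub>1 (UD + VD)\<close> lies in \<open>CD\<close>, so the product Singleton bound
  limits the dimension of \<open>UD + VD\<close>.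
\<close>

lemma critical_RS_code_right:
  fixes C D :: "('a::field ^ 'n) set"
  assumes crit: "critical UNIV d C D" and \<alpha>: "inj \<alpha>" and g: "\<forall>i. g $ i \<noteq> 0"
    and C: "C = RS_code (Suc (Suc k)) g \<alpha>" "vec.dim C = Suc (Suc k)"
  shows "\<exists>h. (\<forall>i. h $ i \<noteq> 0) \<and> D = RS_code (vec.dim D) h \<alpha>"
proof -
  let ?U = "point_U \<alpha>" and ?V = "point_V \<alpha>" and ?R = "RS_code (Suc k) g \<alpha>"
  let ?M = "pencil_sum ?U ?V D"
  have D: "vec.subspace D" and sD: "code_support D = UNIV" and d: "3 \<le> d"
    and dCD: "min_weight_ge d (code_prod C D)"
    using crit by (auto simp: critical_def)
  have card: "vec.dim C + vec.dim D + d = CARD('n) + 2" using critical_card[OF crit] by simp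
  have "code_support ?M = UNIV"
  proof -
    have "\<exists>x\<in>?M. x $ i \<noteq> 0" for i
    proof -
      obtain y where y: "y \<in> D" "y $ i \<noteq> 0" using sD by (auto simp: code_support_def)
      have "?U * y + ?V * 0 \<in> ?M" "?U * 0 + ?V * y \<in> ?M"
        using y(1) vec.subspace_0[OF D] unfolding pencil_sum_def by blast+
      moreover have "(?U * y + ?V * 0) $ i \<noteq> 0 \<or> (?U * 0 + ?V * y) $ i \<noteq> 0"
        using point_nonzero[of \<alpha> i] y(2) by auto
      ultimately show ?thesis by blast
    qed
    then show ?thesis by (auto simp: code_support_def)
  qed
  moreover have "code_prod ?R ?M \<subseteq> code_prod C D"
  proof (rule code_prod_least[OF subspace_code_prod])
    fix x y assume x: "x \<in> ?R" and "y \<in> ?M"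
    then obtain a b where ab: "a \<in> D" "b \<in> D" "y = ?U * a + ?V * b"
      by (auto simp: pencil_sum_def)
    \<comment> \<open>The factors \<open>?U\<close> and \<open>?V\<close> move over to
      \<open>x\<close>, which they carry into \<open>C\<close>.\<close>
    have "x * y = (?U * x) * a + (?V * x) * b" by (simp add: ab(3) algebra_simps)
    then show "x * y \<in> code_prod C D"
      using RS_code_times_mem[OF x] ab(1,2) C(1)
      by (auto intro!: vec.subspace_add[OF subspace_code_prod] times_in_code_prod)
  qed
  ultimately have "vec.dim ?R + vec.dim ?M + d \<le> CARD('n) + 2"
    using product_singleton_bound[OF subspace_RS_code subspace_pencil_sum[OF D] RS_code_support[OF g]]
      min_weight_ge_subset[OF dCD] d by simp
  \<comment> \<open>A lower bound for the dimension of \<open>?R\<close>, read off from that of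
    \<open>C\<close>: one more degree adds at most one dimension.\<close>
  moreover have "Suc (Suc k) \<le> Suc (vec.dim ?R)" using dim_RS_code_Suc[of "Suc k" g \<alpha>] C by simp
  ultimately have "vec.dim ?M \<le> Suc (vec.dim D)" using card C(2) by linarith
  moreover have "min_weight_ge 2 D"
    unfolding min_weight_ge_def
  proof (intro ballI impI)
    fix y assume "y \<in> D" "y \<noteq> 0"
    then have "Suc CARD('n) \<le> vec.dim D + hamming_weight y"
      by (rule critical_weight[OF critical_commute[OF crit]])
    then show "2 \<le> hamming_weight y" using card C(2) d by linarith
  qed
  moreover obtain l where l: "vec.dim D = Suc l"
    using critical_dim_pos[OF critical_commute[OF crit]] not0_implies_Suc by blast
  ultimately obtain h where "D = RS_code (Suc l) h \<alpha>"
    using RS_code_if_pencil_sum_small[OF \<alpha> D] by auto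
  then show ?thesis using RS_code_multiplier_nonzero sD l by metis
qed

section \<open>Minimum distances and the conclusion\<close>

lemma min_weight_ge_d_min: "min_weight_ge (d_min C) C"
  unfolding min_weight_ge_def d_min_def by (auto intro!: wellorder_Inf_le1)

lemma d_min_ge:
  assumes "min_weight_ge d C" "x \<in> C" "x \<noteq> 0"
  shows "d \<le> d_min C"
proof -
  have "{hamming_weight x |x. x \<in> C \<and> x \<noteq> 0} \<noteq> {}" using assms(2,3) by auto
  then have "d_min C \<in> {hamming_weight x |x. x \<in> C \<and> x \<noteq> 0}"
    unfolding d_min_def by (rule Inf_nat_def1)
  then show ?thesis using assms(1) by (auto simp: min_weight_ge_def)
qed

lemma critical_MDS:
  fixes C D :: "('a::field ^ 'n) set"
  assumes crit: "critical UNIV d C D"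
  shows "MDS C"
proof -
  have dim: "vec.dim C \<noteq> 0" using critical_dim_pos[OF crit] by blast
  then obtain x where x: "x \<in> C" "x \<noteq> 0" by (rule dim_nonzeroE)
  have "min_weight_ge (Suc CARD('n) - vec.dim C) C"
    using critical_weight[OF crit] by (fastforce simp: min_weight_ge_def)
  then have "Suc CARD('n) - vec.dim C \<le> d_min C" using x by (rule d_min_ge)
  moreover have "vec.dim C + d_min C \<le> Suc CARD('n)"
    using crit dim min_weight_ge_d_min by (intro singleton_bound) (auto simp: critical_def)
  ultimately show ?thesis by (simp add: MDS_def)
qed

theorem proposition5p4:
  fixes C D :: "('a::{field,finite} ^ 'n) set"
  assumes "vec.subspace C" and "vec.subspace D"
    and "full_support C" and "full_support D"
    and "PMDS C D"
    and "d_min (code_prod C D) > 2"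
  shows "MDS C \<and> MDS D \<and> MDS (code_prod C D) \<and>
    (vec.dim C \<ge> 2 \<and> vec.dim D \<ge> 2 \<longrightarrow>
      (\<exists>\<alpha>. is_RS_with_points \<alpha> C \<and> is_RS_with_points \<alpha> D \<and>
            is_RS_with_points \<alpha> (code_prod C D)))"
proof -
  let ?d = "d_min (code_prod C D)"
  have crit: "critical UNIV ?d C D"
    using assms min_weight_ge_d_min[of "code_prod C D"]
    by (auto simp: critical_def full_support_def code_support_def PMDS_def)
  note dim_prod = critical_dim_prod[OF crit]
  have "MDS (code_prod C D)"
    using dim_prod critical_card[OF crit] by (simp add: MDS_def)
  moreover have "\<exists>\<alpha>. is_RS_with_points \<alpha> C \<and> is_RS_with_points \<alpha> D \<and>
      is_RS_with_points \<alpha> (code_prod C D)" if dims: "2 \<le> vec.dim C" "2 \<le> vec.dim D"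
  proof -
    obtain g \<alpha> where g: "inj \<alpha>" "\<forall>i. g $ i \<noteq> 0" "C = RS_code (vec.dim C) g \<alpha>"
      using critical_RS_code[OF crit dims] by blast
    obtain k where k: "vec.dim C = Suc (Suc k)"
      using dims(1) by (metis add_2_eq_Suc le_Suc_ex)
    obtain h where h: "\<forall>i. h $ i \<noteq> 0" "D = RS_code (vec.dim D) h \<alpha>"
      using critical_RS_code_right[OF crit g(1,2) g(3)[unfolded k] k] by blast
    obtain l where l: "vec.dim D = Suc l" using dims(2) by (metis add_2_eq_Suc le_Suc_ex)
    let ?R = "RS_code (vec.dim (code_prod C D)) (g * h) \<alpha>"
    have kl: "vec.dim (code_prod C D) = Suc (Suc k + l)" using dim_prod k l by simp
    have "code_prod C D \<subseteq> ?R"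
      using RS_code_prod_subset[of "Suc k" g \<alpha> l h] g(3) h(2) unfolding kl k l by simp
    \<comment> \<open>\<open>?R\<close> has dimension at most
      \<open>vec.dim (code_prod C D)\<close>, so the inclusion is an equality.\<close>
    then have "code_prod C D = ?R"
      using dim_RS_code_le by (intro vec.subspace_dim_equal subspace_code_prod subspace_RS_code) auto
    moreover have "\<forall>i. (g * h) $ i \<noteq> 0" using g(2) h(1) by simp
    ultimately show ?thesis
      unfolding is_RS_with_points_def using g h by blast
  qed
  ultimately show ?thesis
    using critical_MDS[OF crit] critical_MDS[OF critical_commute[OF crit]] by blast
qed

end
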